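(* Let $t$ denote the round. Assume that for each $i\in N$: (A1) there is $M_i>0$ such that $a_i\mapsto c_i(a_i,a_{-i},\theta_i,\theta_{-i})$ is $M_i$-strongly convex on $\mathcal{A}_i$, uniformly in the other arguments; (A2) for each $\theta_i\in\Theta_i$ and $\epsilon>0$ there is $\delta>0$ such that $d_{TV}(\eta(\cdot\mid\theta_i;\zeta),\eta(\cdot\mid\theta_i';\zeta))\le\epsilon$ whenever $\|\theta_i'-\theta_i\|\le\delta$, $\theta'_i\in\Theta_i$, uniformly in $\zeta\in\mathcal{Z}$; (A3) $\rho^{\rm al},\rho^{\rm ep}$ are law-invariant convex risk measures; (A4) for every $\epsilon>0$ there is $\delta>0$ such that $|\varrho^{\rm al}(P)-\varrho^{\rm al}(Q)|\le\epsilon$ for all probability measures $P,Q$ on $\mathbb{R}$ with $d_{TV}(P,Q)\le\delta$; (B1) $c_i$ is differentiable in $a_i$; (B2) there are $L_{ij}^{c,0},L_{ij}^{c,1}\ge0$ ($j\ne i$) such that for all $a_{-i},a_{-i}'$ (and all $a_i,\theta_i,\theta_{-i}$), $|c_i(a_i,a_{-i}',\theta_i,\theta_{-i})-c_i(a_i,a_{-i},\theta_i,\theta_{-i})|\le\sum_{j\ne i}L_{ij}^{c,0}\|a_j'-a_j\|$ and $\|\nabla_{a_i}c_i(a_i,a_{-i}',\theta_i,\theta_{-i})-\nabla_{a_i}c_i(a_i,a_{-i},\theta_i,\theta_{-i})\|\le\sum_{j\ne i}L_{ij}^{c,1}\|a_j'-a_j\|$; (B3) with $C_f(\theta_{-i}):=c_i(a_i,f_{-i}(\theta_{-i}),\theta_i,\theta_{-i})$,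 there are $\kappa_i^{{\rm al},0},\kappa_i^{{\rm al},1}\ge0$ such that for all $f_{-i},f_{-i}'\in\mathcal{F}_{-i}$, $\|\nabla_{a_i}\rho^{\rm al}_{\eta(\cdot\mid\theta_i;\zeta)}(C_f)-\nabla_{a_i}\rho^{\rm al}_{\eta(\cdot\mid\theta_i;\zeta)}(C_{f'})\|\le\kappa_i^{{\rm al},1}\sup_{\theta_{-i}}\|\nabla_{a_i}C_f-\nabla_{a_i}C_{f'}\|+\kappa_i^{{\rm al},0}\sup_{\theta_{-i}}|C_f-C_{f'}|$, uniformly for $a_i\in\mathcal{A}_i,\theta_i\in\Theta_i$ and almost surely $\zeta\in\mathcal{Z}$; (B4) with $R_f(\zeta):=\rho^{\rm al}_{\eta(\cdot\mid\theta_i;\zeta)}(C_f)$, there are $\kappa_i^{{\rm ep},0},\kappa_i^{{\rm ep},1}\ge0$ such that for all $f_{-i},f_{-i}'\in\mathcal{F}_{-i}$, $\|\nabla_{a_i}\rho^{\rm ep}_{\mu_i^t}(R_f)-\nabla_{a_i}\rho^{\rm ep}_{\mu_i^t}(R_{f'})\|\le\kappa_i^{{\rm ep},1}\sup_{\zeta\in\mathcal{Z}}\|\nabla_{a_i}R_f(\zeta)-\nabla_{a_i}R_{f'}(\zeta)\|+\kappa_i^{{\rm ep},0}\sup_{\zeta\in\mathcal{Z}}|R_f(\zeta)-R_{f'}(\zeta)|$, uniformly for $a_i\in\mathcal{A}_i,\theta_i\in\Theta_i$; (B5) with $K_{ij}:=\kappa_i^{{\rm ep},1}(\kappa_i^{{\rm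 al},1}L_{ij}^{c,1}+\kappa_i^{{\rm al},0}L_{ij}^{c,0})+\kappa_i^{{\rm ep},0}L_{ij}^{c,0}$ for $j\ne i$, $K_{ii}:=0$, the matrix $\Gamma=(K_{ij}/M_i)_{i,j}$ has spectral radius $r(\Gamma)<1$. Then the following hold. (i) Let $f^\mu$ and $f^{\mu'}$ be two BNE-RABLs corresponding to the posterior profiles $\mu=(\mu_1,\dots,\mu_n)$ and $\mu'=(\mu_1',\dots,\mu_n')$, respectively. Then $$\|f^\mu-f^{\mu'}\|_\infty\le\max_{i\in N}\sum_{j\in N}[(1-\Gamma)^{-1}]_{ij}\,\bar d_j,\qquad \bar d_i:=\frac1{M_i}\sup_{\theta_i\in\Theta_i}\big\|\nabla_{a_i}v_{i,\mu_i'}(f_i^\mu(\theta_i),f_{-i}^\mu,\theta_i)-\nabla_{a_i}v_{i,\mu_i}(f_i^\mu(\theta_i),f_{-i}^\mu,\theta_i)\big\|.$$ (ii) Let $f^{t*}$ be the BNE-RABL at round $t$ (posterior profile $\mu^t$) and $f^*$ the BNE under the true distribution $\eta(\cdot;\zeta^* )$. Assume in addition that: (C1) for each $i\in N$ and any $\epsilon\in(0,1)$ there are $c_1>0$, $c_2(\epsilon)>0$, $T(\epsilon)\ge2$ such that for all $t>T(\epsilon)$, $\mathrm{Prob}^{t-1}_{\eta(\cdot;\zeta^* )}\big(\mathbb{E}_{\mu_i^t}\|\zeta-\zeta^*\|_2^2\le c_2(\epsilon)(t-1)^{-c_1}\big)\ge1-\epsilon$; (C2) for each $i$, $\rho^{\rm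 al}$ is gradient regular with weights $\omega^{\rm al}_{i,\eta(\cdot\mid\theta_i;\zeta)}(\theta_{-i})\in[0,\bar\omega_i^{\rm al}]$ for all $\theta_{-i}$, $\rho^{\rm ep}$ is gradient regular with weights $\omega^{\rm ep}_{i,\mu_i^t}(\zeta)\in[0,\bar\omega_i^{\rm ep}]$ for all $\zeta$, and there is $\lambda_i^{\rm al}$ with $\mathbb{E}_{\eta(\cdot\mid\theta_i;\zeta^* )}\big[|\omega^{\rm al}_{i,\eta(\cdot\mid\theta_i;\zeta)}(\theta_{-i})-\omega^{\rm al}_{i,\eta(\cdot\mid\theta_i;\zeta^* )}(\theta_{-i})|\big]\le\lambda_i^{\rm al}\,d_{TV}(\eta(\cdot\mid\theta_i;\zeta),\eta(\cdot\mid\theta_i;\zeta^* ))$; (C3) for each $i$ and $\theta_i\in\Theta_i$ there are $L_{\eta,i}>0$, $r_i\in(0,2]$, $\epsilon_i>0$ with $d_{TV}(\eta(\cdot\mid\theta_i;\zeta),\eta(\cdot\mid\theta_i;\zeta^* ))\le L_{\eta,i}\|\zeta-\zeta^*\|^{r_i}$ for all $\zeta\in\mathbb{B}(\zeta^*,\epsilon_i)$; (C4) for each $i$ there is $\bar g_i$ with $\sup_{a\in\mathcal{A},\theta\in\Theta}\|\nabla_{a_i}c_i(a_i,a_{-i},\theta_i,\theta_{-i})\|\le\bar g_i$. Then for any $\epsilon\in(0,1)$ there exist positive constants $c_1>0$, $c_2(\epsilon)>0$ and $T(\epsilon)\ge2$ such that for any $t>T(\epsilon)$, $$\mathrm{Prob}^{t-1}_{\eta(\cdot;\zeta^*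 )}\Big(\|f^{t*}-f^*\|_\infty\le\Big(\max_{i\in N}\sum_{j\in N}[(1-\Gamma)^{-1}]_{ij}D_j(\epsilon)\Big)(t-1)^{-\underline r c_1/2}\Big)\ge1-\epsilon,$$ where $\underline r=\min_{i\in N}r_i$ and $$D_i(\epsilon):=\frac1{M_i}\Big(\bar\omega_i^{\rm ep}L_{\eta,i}(\bar\omega_i^{\rm al}\bar g_i+\bar g_i\lambda_i^{\rm al})+2\frac{\bar\omega_i^{\rm ep}\bar g_i}{\epsilon_i^2}\Big)\max\{c_2(\epsilon)^{r_i/2},c_2(\epsilon)\}.$$
   Context: Game. $N=\{1,\dots,n\}$ is the set of players. For each $i\in N$ the type space $\Theta_i\subset\mathbb{R}^{d_i}$ and the action space $\mathcal{A}_i\subset\mathbb{R}^{n_i}$ are nonempty, compact and convex (standing assumption); $\Theta=\prod_j\Theta_j$, $\mathcal{A}=\prod_j\mathcal{A}_j$, and the subscript $-i$ denotes the profile or product over $j\neq i$. The loss $c_i:\mathcal{A}_i\times\mathcal{A}_{-i}\times\Theta_i\times\Theta_{-i}\to\mathbb{R}$ is continuous, hence bounded (standing assumption). $\mathcal{F}_i$ is the set of measurable functions $f_i:\Theta_i\to\mathcal{A}_i$ with $\|f_i\|_\infty=\sup_{\theta_i}\|f_i(\theta_i)\|$; $\mathcal{F}=\prod_j\mathcal{F}_j$, $\mathcal{F}_{-i}=\prod_{j\ne i}\mathcal{F}_j$, $\|f\|_\infty=\max_j\|f_j\|_\infty$. $f_{-i}(\theta_{-i})=(f_j(\theta_j))_{j\neq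 i}$. Distributions. $\{\eta(\cdot;\zeta):\zeta\in\mathcal{Z}\}$ is a parametric family of distributions on $\Theta$ with densities $p(\theta;\zeta)$ and true parameter $\zeta^*\in\mathcal{Z}$; $\eta(\cdot\mid\theta_i;\zeta)$ is the conditional distribution of $\theta_{-i}$ given $\theta_i$. Type profiles $\theta^1,\theta^2,\dots$ are i.i.d. from $\eta(\cdot;\zeta^* )$. Player $i$ has a prior $\mu_i^1$ with density $m_i^1$ on $\mathcal{Z}$; its posterior at round $t$ (after observing $\theta^1,\dots,\theta^{t-1}$) is $\mu_i^t$ with density $m_i^t(\zeta)\propto\prod_{\tau=1}^{t-1}p(\theta^\tau;\zeta)\,m_i^1(\zeta)$; $\mu^t=(\mu_1^t,\dots,\mu_n^t)$. $\mathrm{Prob}^{t-1}_{\eta(\cdot;\zeta^* )}$ is the $(t-1)$-fold product of $\eta(\cdot;\zeta^* )$. $\mathbb{B}(\zeta^*,r)$ is the ball of radius $r$ around $\zeta^*$. Risk measures. A risk measure is a real functional on random losses that is monotone and cash invariant; convex and law invariant have the usual meaning. For law-invariant $\rho$, $\rho_P(X)=\varrho(P\circ X^{-1})$ is its value when the underlying uncertainty has distribution $P$, with $\varrho$ the induced risk functional. $\rho^{\rm al}$ (with induced functional $\varrho^{\rm al}$) is applied to the randomness in $\theta_{-i}$, $\rho^{\rm ep}$ to the randomness in $\zeta$. A risk measure is gradient regular (on bounded differentiable losses) if for any probability measure $P$ and any loss $l(a,\xi)$ differentiable in $a$ there is a measurable weight function $\omega_P$ with $\nabla_a\rho_P(l(a,\xi))=\mathbb{E}_P[\omega_P(\xi)\nabla_al(a,\xi)]$,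 $\mathbb{E}_P[\omega_P(\xi)]=1$ and $\omega_P(\xi)\in[0,\bar\omega]$ for some $\bar\omega>0$. Objective and equilibria. For a belief $\mu_i$ on $\mathcal{Z}$, $v_{i,\mu_i}(a_i,f_{-i},\theta_i):=\rho^{\rm ep}_{\mu_i}\big(\rho^{\rm al}_{\eta(\cdot\mid\theta_i;\zeta)}(c_i(a_i,f_{-i}(\theta_{-i}),\theta_i,\theta_{-i}))\big)$. A BNE-RABL (Bayesian Nash equilibrium among risk-averse Bayesian learners) for a belief profile $\mu$ is $f\in\mathcal{F}$ with $f_i(\theta_i)\in\arg\min_{a_i\in\mathcal{A}_i}v_{i,\mu_i}(a_i,f_{-i},\theta_i)$ for all $i\in N$, $\theta_i\in\Theta_i$. The BNE $f^*$ under the true distribution is the one for $\mu_i=\delta_{\zeta^*}$ (Dirac mass) for all $i$, i.e. with objective $\rho^{\rm al}_{\eta(\cdot\mid\theta_i;\zeta^* )}(c_i(a_i,f_{-i}(\theta_{-i}),\theta_i,\theta_{-i}))$. In $(1-\Gamma)^{-1}$, $1$ denotes the identity matrix. $M$-strong convexity of $g$: $g(\lambda a+(1-\lambda)a')\le\lambda g(a)+(1-\lambda)g(a')-\frac{M}{2}\lambda(1-\lambda)\|a-a'\|^2$ for $\lambda\in[0,1]$. $d_{TV}(P,Q)=\frac12\sup\{|\mathbb{E}_P[h]-\mathbb{E}_Q[h]|: h\text{ measurable},\ \|h\|_\infty\le1\}$.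
   Formalization: In (B4) the suprema over ζ run over the prior-full set of ζ on which (B3) holds, not all of Z; (A4) is only required for laws with a common bounded support; gradient regularity is for losses with bounded gradients; the constants in (C3) do not depend on θ_i. *)

theory Defs
  imports
    "HOL-Probability.Probability"
    "Jordan_Normal_Form.Spectral_Radius"
    "Jordan_Normal_Form.Gauss_Jordan_Elimination"
begin

text \<open>The functions to be differentiated are only given on a compact convex set \<^term>\<open>A\<close>, so
  derivatives are taken within \<^term>\<open>A\<close>, and the gradient is the representing vector that lies in
  the direction space of \<^term>\<open>A\<close>. For convex \<^term>\<open>A\<close> this vector is unique; if \<^term>\<open>A\<close> has nonempty
  interior it is the ordinary gradient. It does not change when the Euclidean space
  containing \<^term>\<open>A\<close> is isometrically embedded into a larger one.\<close>

definition grad :: "'a::euclidean_space set \<Rightarrow> ('a \<Rightarrow> real) \<Rightarrow> 'a \<Rightarrow> 'a" where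
  "grad A f x = (THE g. g \<in> span {y - z | y z. y \<in> A \<and> z \<in> A} \<and>
                        (f has_derivative (\<lambda>h. inner g h)) (at x within A))"

definition strongly_convex_on :: "real \<Rightarrow> 'a::euclidean_space set \<Rightarrow> ('a \<Rightarrow> real) \<Rightarrow> bool" where
  "strongly_convex_on M S g \<longleftrightarrow>
     (\<forall>x\<in>S. \<forall>y\<in>S. \<forall>u\<in>{0..1}. g (u *\<^sub>R x + (1 - u) *\<^sub>R y) \<le>
        u * g x + (1 - u) * g y - M / 2 * u * (1 - u) * (norm (x - y))\<^sup>2)"

text \<open>Only used for probability measures on the same \<open>\<sigma>\<close>-algebra, where the set is bounded.\<close>

definition dTV :: "'w measure \<Rightarrow> 'w measure \<Rightarrow> real" where
  "dTV P Q = 1 / 2 * (SUP h\<in>{h. h \<in> borel_measurable P \<and> (\<forall>x\<in>space P. \<bar>h x\<bar> \<le> 1)}.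
                        \<bar>(LINT x|P. h x) - (LINT x|Q. h x)\<bar>)"

text \<open>Probability at least \<^term>\<open>q\<close>, for events that need not be known to be measurable
  (inner probability).\<close>

definition prob_at_least :: "'w measure \<Rightarrow> real \<Rightarrow> ('w \<Rightarrow> bool) \<Rightarrow> bool" where
  "prob_at_least P q E \<longleftrightarrow> (\<exists>S\<in>sets P. (\<forall>x\<in>S. E x) \<and> q \<le> measure P S)"

definition bounded_loss :: "'w measure \<Rightarrow> ('w \<Rightarrow> real) \<Rightarrow> bool" where
  "bounded_loss P X \<longleftrightarrow> X \<in> borel_measurable P \<and> bounded (X ` space P)"

definition risk_measure :: "'w measure \<Rightarrow> (('w \<Rightarrow> real) \<Rightarrow> real) \<Rightarrow> bool" where
  "risk_measure P rho \<longleftrightarrow>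
     (\<forall>X Y. bounded_loss P X \<longrightarrow> bounded_loss P Y \<longrightarrow> (AE w in P. X w \<le> Y w) \<longrightarrow> rho X \<le> rho Y) \<and>
     (\<forall>X m. bounded_loss P X \<longrightarrow> rho (\<lambda>w. X w + m) = rho X + m)"

definition convex_risk_measure :: "'w measure \<Rightarrow> (('w \<Rightarrow> real) \<Rightarrow> real) \<Rightarrow> bool" where
  "convex_risk_measure P rho \<longleftrightarrow> risk_measure P rho \<and>
     (\<forall>X Y. \<forall>u\<in>{0..1}. bounded_loss P X \<longrightarrow> bounded_loss P Y \<longrightarrow>
        rho (\<lambda>w. u * X w + (1 - u) * Y w) \<le> u * rho X + (1 - u) * rho Y)"

text \<open>A law-invariant risk measure is represented by its induced functional \<^term>\<open>vrho\<close> on the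
  laws of the losses; the measure \<^term>\<open>P\<close> is the distribution of the underlying uncertainty.\<close>

definition risk :: "(real measure \<Rightarrow> real) \<Rightarrow> 'w measure \<Rightarrow> ('w \<Rightarrow> real) \<Rightarrow> real" where
  "risk vrho P X = vrho (distr P borel X)"

definition bounded_differentiable_loss ::
  "'w measure \<Rightarrow> 'a::euclidean_space set \<Rightarrow> ('a \<Rightarrow> 'w \<Rightarrow> real) \<Rightarrow> bool" where
  "bounded_differentiable_loss P A l \<longleftrightarrow>
     (\<forall>a\<in>A. l a \<in> borel_measurable P) \<and>
     (\<forall>w\<in>space P. (\<lambda>x. l x w) differentiable_on A) \<and>
     (\<exists>B. \<forall>a\<in>A. \<forall>w\<in>space P. \<bar>l a w\<bar> \<le> B \<and> norm (grad A (\<lambda>x. l x w) a) \<le> B)"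

text \<open>Gradient regularity with weights \<^term>\<open>W P A l a\<close>. The weight function belongs to the
  distribution \<^term>\<open>P\<close>, but also to the loss \<^term>\<open>l\<close> and the point \<^term>\<open>a\<close> of differentiation
  (for the entropic risk measure, for example, it is proportional to \<open>exp (\<gamma> * l a w)\<close>).\<close>

definition gradient_regular ::
  "(real measure \<Rightarrow> real) \<Rightarrow>
   ('w measure \<Rightarrow> 'a::euclidean_space set \<Rightarrow> ('a \<Rightarrow> 'w \<Rightarrow> real) \<Rightarrow> 'a \<Rightarrow> 'w \<Rightarrow> real) \<Rightarrow> bool" where
  "gradient_regular vrho W \<longleftrightarrow>
     (\<forall>P A l a. prob_space P \<longrightarrow> compact A \<longrightarrow> convex A \<longrightarrow> a \<in> A \<longrightarrow>
        bounded_differentiable_loss P A l \<longrightarrow>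
          W P A l a \<in> borel_measurable P \<and>
          (\<exists>wbar>0. \<forall>w\<in>space P. 0 \<le> W P A l a w \<and> W P A l a w \<le> wbar) \<and>
          (LINT w|P. W P A l a w) = 1 \<and>
          (\<lambda>x. risk vrho P (l x)) differentiable (at a within A) \<and>
          grad A (\<lambda>x. risk vrho P (l x)) a = (LINT w|P. W P A l a w *\<^sub>R grad A (\<lambda>x. l x w) a))"

text \<open>Players are \<open>0, \<dots>, n - 1\<close>. The action spaces \<open>A\<^sub>i \<subseteq> \<real>^n\<^sub>i\<close> and the
  type spaces \<open>\<Theta>\<^sub>i \<subseteq> \<real>^d\<^sub>i\<close> are subsets of common Euclidean spaces \<^typ>\<open>'a\<close> and \<^typ>\<open>'b\<close>;
  different dimensions are covered by isometric embedding, since the \<open>A\<^sub>i\<close>, \<open>\<Theta>\<^sub>i\<close> are not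
  required to be full-dimensional. Profiles are extensional functions on \<open>{..<n}\<close>,
  profiles of the opponents of \<open>i\<close> are extensional functions on \<open>{..<n} - {i}\<close>.

  Densities are taken with respect to arbitrary \<open>\<sigma>\<close>-finite reference measures
  \<open>ref_types\<close> and \<open>ref_params\<close> (Lebesgue measures, for example). The conditional
  distributions \<open>cond i x \<zeta>\<close> of \<open>\<theta>\<^sub>-\<^sub>i\<close> given \<open>\<theta>\<^sub>i = x\<close> are a component of the game
  because they are fixed only up to null sets by the joint distribution, whereas equilibria refer
  to every \<open>x \<in> \<Theta>\<^sub>i\<close>. The last two components are the induced functionals of the
  aleatoric and the epistemic risk measure.\<close>

record ('a, 'b, 'z) bayes_game =
  n_players  :: nat
  Acts       :: "nat \<Rightarrow> 'a set"
  Types      :: "nat \<Rightarrow> 'b set"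
  cost       :: "nat \<Rightarrow> (nat \<Rightarrow> 'a) \<Rightarrow> (nat \<Rightarrow> 'b) \<Rightarrow> real"
  Params     :: "'z set"
  true_param :: 'z
  ref_types  :: "(nat \<Rightarrow> 'b) measure"
  dens       :: "(nat \<Rightarrow> 'b) \<Rightarrow> 'z \<Rightarrow> real"
  cond       :: "nat \<Rightarrow> 'b \<Rightarrow> 'z \<Rightarrow> (nat \<Rightarrow> 'b) measure"
  ref_params :: "'z measure"
  prior_dens :: "nat \<Rightarrow> 'z \<Rightarrow> real"
  rho_al     :: "real measure \<Rightarrow> real"
  rho_ep     :: "real measure \<Rightarrow> real"

abbreviation Players :: "('a, 'b, 'z) bayes_game \<Rightarrow> nat set" where
  "Players G \<equiv> {..<n_players G}"

definition action_profiles :: "('a, 'b, 'z) bayes_game \<Rightarrow> (nat \<Rightarrow> 'a) set" where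
  "action_profiles G = PiE (Players G) (Acts G)"

definition type_profiles :: "('a, 'b, 'z) bayes_game \<Rightarrow> (nat \<Rightarrow> 'b) set" where
  "type_profiles G = PiE (Players G) (Types G)"

definition types_space ::
  "('a, 'b::euclidean_space, 'z) bayes_game \<Rightarrow> nat set \<Rightarrow> (nat \<Rightarrow> 'b) measure" where
  "types_space G J = PiM J (\<lambda>j. restrict_space borel (Types G j))"

abbreviation others :: "('a, 'b, 'z) bayes_game \<Rightarrow> nat \<Rightarrow> nat set" where
  "others G i \<equiv> Players G - {i}"

definition opp_types :: "('a, 'b, 'z) bayes_game \<Rightarrow> nat \<Rightarrow> (nat \<Rightarrow> 'b) set" where
  "opp_types G i = PiE (others G i) (Types G)"

text \<open>\<open>strategies G J\<close> are the profiles of measurable strategies of the players in \<open>J\<close>; the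
  values at other indices are irrelevant.\<close>

definition strategies ::
  "('a::euclidean_space, 'b::euclidean_space, 'z) bayes_game \<Rightarrow> nat set \<Rightarrow> (nat \<Rightarrow> 'b \<Rightarrow> 'a) set" where
  "strategies G J = {f. \<forall>j\<in>J. f j \<in> measurable (restrict_space borel (Types G j))
                                                (restrict_space borel (Acts G j))}"

definition strategy_norm ::
  "('a::euclidean_space, 'b, 'z) bayes_game \<Rightarrow> (nat \<Rightarrow> 'b \<Rightarrow> 'a) \<Rightarrow> real" where
  "strategy_norm G f = (MAX j\<in>Players G. SUP x\<in>Types G j. norm (f j x))"

definition eta :: "('a, 'b, 'z) bayes_game \<Rightarrow> 'z \<Rightarrow> (nat \<Rightarrow> 'b) measure" where
  "eta G z = density (ref_types G) (\<lambda>\<theta>. ennreal (dens G \<theta> z))"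

definition prior :: "('a, 'b, 'z) bayes_game \<Rightarrow> nat \<Rightarrow> 'z measure" where
  "prior G i = density (ref_params G) (\<lambda>z. ennreal (prior_dens G i z))"

text \<open>The histories \<open>\<theta>\<^sup>1, \<dots>, \<theta>\<^sup>t\<^sup>-\<^sup>1\<close> observed before round \<open>t \<ge> 1\<close>, with the
  \<open>(t-1)\<close>-fold product of the true distribution.\<close>

definition histories :: "('a, 'b, 'z) bayes_game \<Rightarrow> nat \<Rightarrow> (nat \<Rightarrow> nat \<Rightarrow> 'b) measure" where
  "histories G t = PiM {1..<t} (\<lambda>_. eta G (true_param G))"

definition posterior_weight ::
  "('a, 'b, 'z) bayes_game \<Rightarrow> nat \<Rightarrow> nat \<Rightarrow> (nat \<Rightarrow> nat \<Rightarrow> 'b) \<Rightarrow> 'z \<Rightarrow> ennreal" where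
  "posterior_weight G i t h z = ennreal ((\<Prod>\<tau>\<in>{1..<t}. dens G (h \<tau>) z) * prior_dens G i z)"

definition evidence ::
  "('a, 'b, 'z) bayes_game \<Rightarrow> nat \<Rightarrow> nat \<Rightarrow> (nat \<Rightarrow> nat \<Rightarrow> 'b) \<Rightarrow> ennreal" where
  "evidence G i t h = (\<integral>\<^sup>+z. posterior_weight G i t h z \<partial>ref_params G)"

text \<open>Bayes' rule defines a posterior only if the normalizing constant is positive and finite.\<close>

definition posterior_defined ::
  "('a, 'b, 'z) bayes_game \<Rightarrow> nat \<Rightarrow> nat \<Rightarrow> (nat \<Rightarrow> nat \<Rightarrow> 'b) \<Rightarrow> bool" where
  "posterior_defined G i t h \<longleftrightarrow> 0 < evidence G i t h \<and> evidence G i t h < \<infinity>"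

definition posterior ::
  "('a, 'b, 'z) bayes_game \<Rightarrow> nat \<Rightarrow> nat \<Rightarrow> (nat \<Rightarrow> nat \<Rightarrow> 'b) \<Rightarrow> 'z measure" where
  "posterior G i t h =
     density (ref_params G) (\<lambda>z. posterior_weight G i t h z / evidence G i t h)"

definition posteriors :: "('a, 'b, 'z) bayes_game \<Rightarrow> nat \<Rightarrow> 'z measure set" where
  "posteriors G i =
     {posterior G i t h | t h. 1 \<le> t \<and> h \<in> space (histories G t) \<and> posterior_defined G i t h}"

definition true_belief :: "('a, 'b, 'z::euclidean_space) bayes_game \<Rightarrow> 'z measure" where
  "true_belief G = return (restrict_space borel (Params G)) (true_param G)"

text \<open>\<open>loss G i f x a \<xi>\<close> is \<open>c\<^sub>i(a, f\<^sub>-\<^sub>i(\<xi>), x, \<xi>)\<close> for \<open>\<xi> = \<theta>\<^sub>-\<^sub>i\<close>.\<close>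

definition loss ::
  "('a, 'b, 'z) bayes_game \<Rightarrow> nat \<Rightarrow> (nat \<Rightarrow> 'b \<Rightarrow> 'a) \<Rightarrow> 'b \<Rightarrow> 'a \<Rightarrow> (nat \<Rightarrow> 'b) \<Rightarrow> real" where
  "loss G i f x a \<xi> = cost G i (\<lambda>j\<in>Players G. if j = i then a else f j (\<xi> j)) (\<xi>(i := x))"

definition al_risk ::
  "('a, 'b, 'z) bayes_game \<Rightarrow> nat \<Rightarrow> (nat \<Rightarrow> 'b \<Rightarrow> 'a) \<Rightarrow> 'b \<Rightarrow> 'a \<Rightarrow> 'z \<Rightarrow> real" where
  "al_risk G i f x a z = risk (rho_al G) (cond G i x z) (loss G i f x a)"

definition objective ::
  "('a, 'b, 'z) bayes_game \<Rightarrow> nat \<Rightarrow> 'z measure \<Rightarrow> (nat \<Rightarrow> 'b \<Rightarrow> 'a) \<Rightarrow> 'b \<Rightarrow> 'a \<Rightarrow> real" where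
  "objective G i \<mu> f x a = risk (rho_ep G) \<mu> (al_risk G i f x a)"

definition BNE_RABL ::
  "('a::euclidean_space, 'b::euclidean_space, 'z) bayes_game \<Rightarrow> (nat \<Rightarrow> 'z measure) \<Rightarrow>
   (nat \<Rightarrow> 'b \<Rightarrow> 'a) \<Rightarrow> bool" where
  "BNE_RABL G \<mu> f \<longleftrightarrow> f \<in> strategies G (Players G) \<and>
     (\<forall>i\<in>Players G. \<forall>x\<in>Types G i.
        is_arg_min (objective G i (\<mu> i) f x) (\<lambda>a. a \<in> Acts G i) (f i x))"

text \<open>Continuity refers to the product topology on functions, which on extensional functions
  over a finite index set is the topology of the finite product.\<close>

definition game_spaces ::
  "('a::euclidean_space, 'b::euclidean_space, 'z::euclidean_space) bayes_game \<Rightarrow> bool" where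
  "game_spaces G \<longleftrightarrow>
     0 < n_players G \<and>
     (\<forall>i\<in>Players G. Acts G i \<noteq> {} \<and> compact (Acts G i) \<and> convex (Acts G i)) \<and>
     (\<forall>i\<in>Players G. Types G i \<noteq> {} \<and> compact (Types G i) \<and> convex (Types G i)) \<and>
     (\<forall>i\<in>Players G. continuous_on (action_profiles G \<times> type_profiles G) (\<lambda>(a, \<theta>). cost G i a \<theta>)) \<and>
     Params G \<in> sets borel \<and> true_param G \<in> Params G"

definition game_distributions ::
  "('a::euclidean_space, 'b::euclidean_space, 'z::euclidean_space) bayes_game \<Rightarrow> bool" where
  "game_distributions G \<longleftrightarrow>
     sigma_finite_measure (ref_types G) \<and>
     sets (ref_types G) = sets (types_space G (Players G)) \<and>
     (\<lambda>(\<theta>, z). dens G \<theta> z) \<in>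
        borel_measurable (types_space G (Players G) \<Otimes>\<^sub>M restrict_space borel (Params G)) \<and>
     (\<forall>\<theta>\<in>type_profiles G. \<forall>z\<in>Params G. 0 \<le> dens G \<theta> z) \<and>
     (\<forall>z\<in>Params G. prob_space (eta G z))"

text \<open>\<open>cond G i \<cdot> z\<close> is a regular conditional distribution of \<open>\<theta>\<^sub>-\<^sub>i\<close> given \<open>\<theta>\<^sub>i\<close> under
  \<open>eta G z\<close>.\<close>

definition game_conditionals ::
  "('a::euclidean_space, 'b::euclidean_space, 'z::euclidean_space) bayes_game \<Rightarrow> bool" where
  "game_conditionals G \<longleftrightarrow>
     (\<forall>i\<in>Players G. \<forall>z\<in>Params G.
        (\<lambda>x. cond G i x z) \<in> measurable (restrict_space borel (Types G i))
                                         (prob_algebra (types_space G (others G i))) \<and>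
        (\<forall>E\<in>sets (types_space G (Players G)).
           emeasure (eta G z) E =
           (\<integral>\<^sup>+\<theta>. emeasure (cond G i (\<theta> i) z) {\<xi>\<in>opp_types G i. \<xi>(i := \<theta> i) \<in> E} \<partial>eta G z)))"

text \<open>The last condition says that the true data almost surely lead to well-defined posteriors.\<close>

definition game_beliefs ::
  "('a::euclidean_space, 'b::euclidean_space, 'z::euclidean_space) bayes_game \<Rightarrow> bool" where
  "game_beliefs G \<longleftrightarrow>
     sigma_finite_measure (ref_params G) \<and>
     sets (ref_params G) = sets (restrict_space borel (Params G)) \<and>
     (\<forall>i\<in>Players G. prior_dens G i \<in> borel_measurable (ref_params G) \<and>
        (\<forall>z\<in>Params G. 0 \<le> prior_dens G i z) \<and> prob_space (prior G i)) \<and>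
     (\<forall>i\<in>Players G. \<forall>t\<ge>1. AE h in histories G t. posterior_defined G i t h)"

text \<open>The inner risk is a random variable on the parameter space, so that the outer risk measure
  can be applied to it.\<close>

definition al_risk_measurable ::
  "('a::euclidean_space, 'b::euclidean_space, 'z::euclidean_space) bayes_game \<Rightarrow> bool" where
  "al_risk_measurable G \<longleftrightarrow>
     (\<forall>i\<in>Players G. \<forall>f\<in>strategies G (others G i). \<forall>x\<in>Types G i. \<forall>a\<in>Acts G i.
        al_risk G i f x a \<in> borel_measurable (restrict_space borel (Params G)))"

definition bayes_game ::
  "('a::euclidean_space, 'b::euclidean_space, 'z::euclidean_space) bayes_game \<Rightarrow> bool" where
  "bayes_game G \<longleftrightarrow> game_spaces G \<and> game_distributions G \<and> game_conditionals G \<and>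
     game_beliefs G \<and> al_risk_measurable G"

end

theory Submission
  imports Defs
begin

text \<open>An equilibrium strategy minimizes the objective of player \<open>i\<close> pointwise, and the monotone convex
  risk measures preserve the strong convexity of the loss. Strong convexity bounds the distance of
  the minimizers of two objectives by the difference of their gradients at one of them. Changing
  the strategies of the opponents contributes at most \<open>\<Sum>\<^sub>j K\<^sub>i\<^sub>j \<delta>\<^sub>j\<close> to this difference, changing
  the belief contributes \<open>M\<^sub>i d\<^sub>i\<close>; hence the vector \<open>\<delta>\<close> of the distances of the strategies satisfies
  \<open>\<delta> \<le> \<Gamma> \<delta> + d\<close>, and \<open>(1 - \<Gamma>)\<^sup>-\<^sup>1 \<ge> 0\<close> gives \<open>\<delta> \<le> (1 - \<Gamma>)\<^sup>-\<^sup>1 d\<close>.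

  For the rate, gradient regularity turns \<open>d\<^sub>i\<close> into the posterior mean of the difference between
  the gradients of the aleatoric risk at \<open>\<zeta>\<close> and at \<open>\<zeta>\<^sup>*\<close>. Near \<open>\<zeta>\<^sup>*\<close> this is controlled by the total
  variation distance of the conditional distributions, away from \<open>\<zeta>\<^sup>*\<close> by \<open>2 g\<^sub>i\<close> (the gradient bound),
  and both by the second moment of the posterior. The same equilibrium estimate applies to the
  Dirac belief because the Lipschitz condition on the outer risk is only used at the posterior.\<close>

section \<open>Gradients on convex sets and minimizers\<close>

text \<open>The equilibria \<open>f\<close> (belief \<mu>) and \<open>f'\<close> (belief \<mu>')
  enter asymmetrically. Strong convexity and the Lipschitz dependence on the opponents are applied
  to the objective under \<mu>', both gradients are taken at the action of \<open>f\<close>, and the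
  objective under \<mu>' against the opponents in \<open>f\<close> is the intermediate term. Of
  \<mu> this demands only differentiability at the actions of \<open>f\<close>. In the rate, \<mu>
  is therefore the Dirac belief and \<open>f\<close> the true equilibrium, because (B4) speaks of
  posteriors only.

  No Neumann series is summed: invertibility of 1 - \<Gamma>, nonnegativity of the inverse and the
  resulting bound all follow from one fact, that a nonnegative vector y with y \<le> \<Gamma> y
  vanishes.

  Derivatives exist only within the convex action set, so every first-order argument runs along
  segments inside it, and vectors are compared only on the direction space of the set.

  The risk measures are not normalized. Hence the risk of the zero loss appears as an additive
  constant in the bounds and in the Dirac objective; it disappears in gradients.\<close>

lemma has_derivative_within_right_limit:
  fixes f :: "'a::real_normed_vector \<Rightarrow> real"
  assumes f: "(f has_derivative D) (at x within A)" and A: "convex A" "x \<in> A" "y \<in> A"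
  shows "((\<lambda>u. (f (x + u *\<^sub>R (y - x)) - f x) / u) \<longlongrightarrow> D (y - x)) (at_right 0)"
proof -
  \<comment> \<open>Only paths that stay in \<open>A\<close> are visible to a derivative within
    \<open>A\<close>. By convexity this segment stays there for parameters in \<open>{0..1}\<close>,
    where the limit at 0 is a right limit.\<close>
  define p where "p u = x + u *\<^sub>R (y - x)" for u :: real
  have p: "p u \<in> A" if "u \<in> {0..1}" for u
    using convexD_alt[OF A(1) A(2) A(3), of u] that by (simp add: p_def algebra_simps)
  have p0: "p 0 = x" by (simp add: p_def)
  have "(p has_derivative (\<lambda>u. u *\<^sub>R (y - x))) (at 0 within {0..1})"
    unfolding p_def by (auto intro!: derivative_eq_intros)
  moreover have "(f has_derivative D) (at (p 0) within p ` {0..1})"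
    unfolding p0 by (rule has_derivative_subset[OF f]) (use p in blast)
  ultimately have "((f \<circ> p) has_derivative (D \<circ> (\<lambda>u. u *\<^sub>R (y - x)))) (at 0 within {0..1})"
    by (rule diff_chain_within)
  moreover have "D (u *\<^sub>R (y - x)) = D (y - x) * u" for u
    using f by (simp add: has_derivative_bounded_linear linear_simps(5) mult.commute)
  ultimately have "((f \<circ> p) has_field_derivative D (y - x)) (at 0 within {0..1})"
    by (simp add: has_field_derivative_def o_def mult_commute_abs)
  then have "((\<lambda>u. (f (p u) - f x) / u) \<longlongrightarrow> D (y - x)) (at 0 within {0..1})"
    by (simp add: has_field_derivative_iff p0)
  moreover have "at (0::real) within {0..1} = at_right 0"
    using at_within_Icc_at_right[of "0::real" 1] by simp
  ultimately show ?thesis by (simp add: p_def)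
qed

text \<open>One-sided limits along segments fix the derivative on all differences from
  \<open>x\<close>, and these differences span the direction space of \<open>A\<close>.\<close>

lemma has_derivative_within_convex_unique:
  fixes f :: "'a::euclidean_space \<Rightarrow> real"
  assumes g: "(f has_derivative (\<lambda>h. inner g h)) (at x within A)"
    and g': "(f has_derivative (\<lambda>h. inner g' h)) (at x within A)"
    and A: "convex A" "x \<in> A" and v: "v \<in> span {y - z | y z. y \<in> A \<and> z \<in> A}"
  shows "inner g v = inner g' v"
  using v
proof (rule real_vector.span_induct)
  show "real_vector.subspace {v. inner g v = inner g' v}"
    by (auto intro!: real_vector.subspaceI simp: inner_add_right)
next
  have *: "inner g (y - x) = inner g' (y - x)" if "y \<in> A" for y
    using tendsto_unique[OF _ has_derivative_within_right_limit[OF g A that]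
      has_derivative_within_right_limit[OF g' A that]] by simp
  fix v assume "v \<in> {y - z | y z. y \<in> A \<and> z \<in> A}"
  then obtain y z where "v = (y - x) - (z - x)" "y \<in> A" "z \<in> A" by auto
  then show "inner g v = inner g' v" using * by (simp only: inner_diff_right)
qed

lemma grad_eqI:
  assumes A: "convex A" "x \<in> A" and "g \<in> span {y - z | y z. y \<in> A \<and> z \<in> A}"
    and "(f has_derivative (\<lambda>h. inner g h)) (at x within A)"
  shows "grad A f x = g"
  unfolding grad_def
proof (rule the_equality)
  let ?S = "{y - z | y z. y \<in> A \<and> z \<in> A}"
  fix g' assume g': "g' \<in> span ?S \<and> (f has_derivative (\<lambda>h. inner g' h)) (at x within A)"
  have "inner g' (g' - g) = inner g (g' - g)"
    using assms g' by (intro has_derivative_within_convex_unique[of f]) (auto intro: real_vector.span_diff)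
  then have "inner (g' - g) (g' - g) = 0" by (simp add: inner_diff_left)
  then show "g' = g" by simp
qed (use assms in simp)

text \<open>Any derivative is represented by the vector \<open>adjoint D 1\<close>. Its component
  orthogonal to the direction space vanishes on every increment within \<open>A\<close>, so dropping
  it leaves a derivative within \<open>A\<close> whose representing vector lies in the direction
  space.\<close>

lemma has_derivative_grad:
  fixes f :: "'a::euclidean_space \<Rightarrow> real"
  assumes A: "convex A" "x \<in> A" and f: "f differentiable (at x within A)"
  shows "(f has_derivative (\<lambda>h. inner (grad A f x) h)) (at x within A)"
    and "grad A f x \<in> span {y - z | y z. y \<in> A \<and> z \<in> A}"
proof -
  let ?S = "{y - z | y z. y \<in> A \<and> z \<in> A}"
  obtain D where D: "(f has_derivative D) (at x within A)"
    using f by (auto simp: differentiable_def)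
  have lin: "linear D" using D by (simp add: has_derivative_linear)
  have D_adj: "D h = inner (adjoint D 1) h" for h
    using adjoint_works[OF lin, of h 1] by (simp add: inner_commute)
  obtain g n where g: "g \<in> span ?S" and n: "\<And>w. w \<in> span ?S \<Longrightarrow> real_inner_class.orthogonal n w"
    and gn: "adjoint D 1 = g + n"
    using orthogonal_subspace_decomp_exists[of ?S "adjoint D 1"] by blast
  have "inner n (y - x) = 0" if "y \<in> A" for y
    using n[of "y - x"] that A(2) by (auto simp: real_inner_class.orthogonal_def intro!: real_vector.span_base)
  then have eq: "D (y - x) = inner g (y - x)" if "y \<in> A" for y
    using that by (simp add: D_adj gn inner_add_left)
  have "(f has_derivative (\<lambda>h. inner g h)) (at x within A)"
    using D unfolding has_derivative_within
    by (auto simp: bounded_linear_inner_right elim!: Lim_transform_within[where d=1] simp: eq)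
  with grad_eqI[OF A g this] g
  show "(f has_derivative (\<lambda>h. inner (grad A f x) h)) (at x within A)"
    "grad A f x \<in> span ?S" by auto
qed

text \<open>Made for the Dirac belief: on the action set its objective is the aleatoric risk at the
  true parameter shifted by a constant, and nothing is known about the two functions
  elsewhere.\<close>

lemma grad_cong_diff:
  fixes f :: "'a::euclidean_space \<Rightarrow> real"
  assumes A: "convex A" "x \<in> A" and f: "f differentiable (at x within A)"
    and fg: "\<And>y. y \<in> A \<Longrightarrow> g y = f y + c"
  shows "g differentiable (at x within A)" and "grad A g x = grad A f x"
proof -
  have "((\<lambda>y. f y + c) has_derivative (\<lambda>h. inner (grad A f x) h)) (at x within A)"
    using has_derivative_grad(1)[OF A f] by (auto intro!: derivative_eq_intros)
  then have D: "(g has_derivative (\<lambda>h. inner (grad A f x) h)) (at x within A)"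
    by (rule has_derivative_transform[OF A(2), rotated]) (simp add: fg)
  show "grad A g x = grad A f x"
    by (rule grad_eqI[OF A has_derivative_grad(2)[OF A f] D])
  show "g differentiable (at x within A)" using D by (auto simp: differentiable_def)
qed

text \<open>A directional derivative is the limit of difference quotients along a sequence of step
  sizes, and each quotient is a combination of two measurable losses.\<close>

lemma inner_grad_measurable:
  fixes l :: "'a::euclidean_space \<Rightarrow> 'w \<Rightarrow> real"
  assumes A: "convex A" "x \<in> A" and meas: "\<And>a. a \<in> A \<Longrightarrow> l a \<in> borel_measurable P"
    and diff: "\<And>w. w \<in> space P \<Longrightarrow> (\<lambda>a. l a w) differentiable (at x within A)"
    and y: "y \<in> A"
  shows "(\<lambda>w. inner (grad A (\<lambda>a. l a w) x) (y - x)) \<in> borel_measurable P"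
proof (rule borel_measurable_LIMSEQ_real)
  define u where "u n = inverse (real (Suc n))" for n
  have u: "filterlim u (at_right 0) sequentially"
    unfolding filterlim_at
  proof
    show "u \<longlonglongrightarrow> 0" unfolding u_def by (rule LIMSEQ_inverse_real_of_nat)
    show "\<forall>\<^sub>F n in sequentially. u n \<in> {0<..} \<and> u n \<noteq> 0" by (simp add: u_def)
  qed
  show "(\<lambda>n. (l (x + u n *\<^sub>R (y - x)) w - l x w) / u n) \<longlonglongrightarrow> inner (grad A (\<lambda>a. l a w) x) (y - x)"
    if "w \<in> space P" for w
    using filterlim_compose[OF has_derivative_within_right_limit[OF has_derivative_grad(1)[OF A diff[OF that]] A y] u] .
  fix n
  have u01: "0 \<le> u n" "u n \<le> 1" by (auto simp: u_def field_simps)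
  have "x + u n *\<^sub>R (y - x) \<in> A"
    using convexD_alt[OF A(1) A(2) y, of "u n"] u01 by (simp add: algebra_simps)
  then show "(\<lambda>w. (l (x + u n *\<^sub>R (y - x)) w - l x w) / u n) \<in> borel_measurable P"
    using meas[of x] meas[of "x + u n *\<^sub>R (y - x)"] A(2) by measurable
qed

text \<open>Difference quotients reach only directions in the span of \<open>A - A\<close>. In the
  orthogonal directions the gradient has component 0 by its normalization in \<open>grad\<close>, so
  every coordinate is measurable.\<close>

lemma grad_measurable:
  fixes l :: "'a::euclidean_space \<Rightarrow> 'w \<Rightarrow> real"
  assumes A: "convex A" "x \<in> A" and meas: "\<And>a. a \<in> A \<Longrightarrow> l a \<in> borel_measurable P"
    and diff: "\<And>w. w \<in> space P \<Longrightarrow> (\<lambda>a. l a w) differentiable (at x within A)"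
  shows "(\<lambda>w. grad A (\<lambda>a. l a w) x) \<in> borel_measurable P"
proof -
  let ?S = "{y - z | y z. y \<in> A \<and> z \<in> A}"
  let ?g = "\<lambda>w. grad A (\<lambda>a. l a w) x"
  have span: "(\<lambda>w. inner (?g w) v) \<in> borel_measurable P" if "v \<in> span ?S" for v
    using that
  proof (rule real_vector.span_induct)
    show "real_vector.subspace {v. (\<lambda>w. inner (?g w) v) \<in> borel_measurable P}"
      by (auto intro!: real_vector.subspaceI simp: inner_add_right)
    fix v assume "v \<in> ?S"
    then obtain y z where v: "v = (y - x) - (z - x)" "y \<in> A" "z \<in> A" by auto
    show "(\<lambda>w. inner (?g w) v) \<in> borel_measurable P"
      unfolding v(1) inner_diff_right[of _ "y - x"]
      by (intro borel_measurable_diff inner_grad_measurable[OF A meas diff] v)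
  qed
  have "(\<lambda>w. inner (?g w) b) \<in> borel_measurable P" for b
  proof -
    obtain s n where s: "s \<in> span ?S" and n: "\<And>w. w \<in> span ?S \<Longrightarrow> real_inner_class.orthogonal n w" and b: "b = s + n"
      using orthogonal_subspace_decomp_exists[of ?S b] by blast
    have "inner (?g w) b = inner (?g w) s" if "w \<in> space P" for w
      using n[OF has_derivative_grad(2)[OF A diff[OF that]]]
      by (simp add: b inner_add_left real_inner_class.orthogonal_def inner_commute)
    then show ?thesis using span[OF s] by (simp cong: measurable_cong)
  qed
  then show ?thesis by (subst borel_measurable_euclidean_space) blast
qed

section \<open>First-order conditions and quadratic growth at minimizers\<close>

lemma grad_minimizer_nonneg:
  fixes U :: "'a::euclidean_space \<Rightarrow> real"
  assumes A: "convex A" "b \<in> A" and U: "U differentiable (at a within A)"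
    and min: "is_arg_min U (\<lambda>a. a \<in> A) a"
  shows "0 \<le> inner (grad A U a) (b - a)"
proof (rule tendsto_lowerbound)
  have a: "a \<in> A" using min by (simp add: is_arg_min_linorder)
  show "((\<lambda>u. (U (a + u *\<^sub>R (b - a)) - U a) / u) \<longlongrightarrow> inner (grad A U a) (b - a)) (at_right 0)"
    by (rule has_derivative_within_right_limit[OF has_derivative_grad(1)[OF A(1) a U] A(1) a A(2)])
  have "0 \<le> (U (a + u *\<^sub>R (b - a)) - U a) / u" if "0 < u" "u < 1" for u
  proof -
    have "a + u *\<^sub>R (b - a) \<in> A"
      using convexD_alt[OF A(1) a A(2), of u] that by (simp add: algebra_simps)
    then show ?thesis using min that by (simp add: is_arg_min_linorder)
  qed
  then show "\<forall>\<^sub>F u in at_right 0. 0 \<le> (U (a + u *\<^sub>R (b - a)) - U a) / u"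
    by (intro eventually_at_rightI[of 0 1]) auto
qed simp

text \<open>Strong convexity at a point of the segment, divided by the step size. Letting
  \<open>u\<close> tend to 0 then yields both the gradient inequality and the growth at a minimizer;
  the latter needs no derivative, since there the left side is nonnegative.\<close>

lemma strongly_convex_quotient_le:
  assumes V: "strongly_convex_on M A V" and ab: "a \<in> A" "b \<in> A" and u: "0 < u" "u < (1::real)"
  shows "(V (a + u *\<^sub>R (b - a)) - V a) / u \<le> V b - V a - M / 2 * (1 - u) * (norm (b - a))\<^sup>2"
proof -
  have "V (u *\<^sub>R b + (1 - u) *\<^sub>R a) \<le> u * V b + (1 - u) * V a - M / 2 * u * (1 - u) * (norm (b - a))\<^sup>2"
    using V ab u by (simp add: strongly_convex_on_def)
  moreover have "u *\<^sub>R b + (1 - u) *\<^sub>R a = a + u *\<^sub>R (b - a)" by (simp add: algebra_simps)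
  ultimately have "V (a + u *\<^sub>R (b - a)) - V a \<le> (V b - V a - M / 2 * (1 - u) * (norm (b - a))\<^sup>2) * u"
    by (simp add: algebra_simps)
  then show ?thesis using u by (simp add: divide_le_eq)
qed

lemma strongly_convex_grad_le:
  fixes V :: "'a::euclidean_space \<Rightarrow> real"
  assumes A: "convex A" "a \<in> A" "b \<in> A" and V: "V differentiable (at a within A)"
    and sc: "strongly_convex_on M A V"
  shows "inner (grad A V a) (b - a) \<le> V b - V a - M / 2 * (norm (b - a))\<^sup>2"
proof (rule tendsto_le)
  show "((\<lambda>u. (V (a + u *\<^sub>R (b - a)) - V a) / u) \<longlongrightarrow> inner (grad A V a) (b - a)) (at_right 0)"
    by (rule has_derivative_within_right_limit[OF has_derivative_grad(1)[OF A(1,2) V] A])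
  show "((\<lambda>u. V b - V a - M / 2 * (1 - u) * (norm (b - a))\<^sup>2) \<longlongrightarrow> V b - V a - M / 2 * (norm (b - a))\<^sup>2) (at_right 0)"
    by (auto intro!: tendsto_eq_intros)
  show "\<forall>\<^sub>F u in at_right 0. (V (a + u *\<^sub>R (b - a)) - V a) / u \<le> V b - V a - M / 2 * (1 - u) * (norm (b - a))\<^sup>2"
    using strongly_convex_quotient_le[OF sc A(2,3)] by (intro eventually_at_rightI[of 0 1]) auto
qed simp

lemma strongly_convex_minimizer_le:
  fixes V :: "'a::euclidean_space \<Rightarrow> real"
  assumes A: "convex A" "b \<in> A" and sc: "strongly_convex_on M A V"
    and min: "is_arg_min V (\<lambda>a. a \<in> A) a"
  shows "V a + M / 2 * (norm (b - a))\<^sup>2 \<le> V b"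
proof -
  have a: "a \<in> A" using min by (simp add: is_arg_min_linorder)
  have "0 \<le> V b - V a - M / 2 * (norm (b - a))\<^sup>2"
  proof (rule tendsto_lowerbound)
    show "((\<lambda>u. V b - V a - M / 2 * (1 - u) * (norm (b - a))\<^sup>2) \<longlongrightarrow> V b - V a - M / 2 * (norm (b - a))\<^sup>2) (at_right 0)"
      by (auto intro!: tendsto_eq_intros)
    have "0 \<le> V b - V a - M / 2 * (1 - u) * (norm (b - a))\<^sup>2" if u: "0 < u" "u < 1" for u
    proof -
      have "a + u *\<^sub>R (b - a) \<in> A"
        using convexD_alt[OF A(1) a A(2), of u] u by (simp add: algebra_simps)
      then have "0 \<le> (V (a + u *\<^sub>R (b - a)) - V a) / u"
        using min u by (simp add: is_arg_min_linorder)
      then show ?thesis using strongly_convex_quotient_le[OF sc a A(2) u] by linarith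
    qed
    then show "\<forall>\<^sub>F u in at_right 0. 0 \<le> V b - V a - M / 2 * (1 - u) * (norm (b - a))\<^sup>2"
      by (intro eventually_at_rightI[of 0 1]) auto
  qed simp
  then show ?thesis by simp
qed

lemma minimizer_distance_le_grad:
  fixes U V :: "'a::euclidean_space \<Rightarrow> real"
  assumes A: "convex A" and sc: "strongly_convex_on M A V"
    and V: "V differentiable (at a within A)" and U: "U differentiable (at a within A)"
    and minU: "is_arg_min U (\<lambda>a. a \<in> A) a" and minV: "is_arg_min V (\<lambda>a. a \<in> A) b"
  shows "M * norm (a - b) \<le> norm (grad A V a - grad A U a)"
proof (cases "a = b")
  case False
  have ab: "a \<in> A" "b \<in> A" using minU minV by (auto simp: is_arg_min_linorder)
  \<comment> \<open>One half of \<open>M\<close> comes from the gradient inequality of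
    \<open>V\<close> at \<open>a\<close>, the other half from the quadratic growth of
    \<open>V\<close> away from its minimizer \<open>b\<close>.\<close>
  have "M * (norm (a - b))\<^sup>2 \<le> inner (grad A V a) (a - b)"
    using strongly_convex_grad_le[OF A ab V sc] strongly_convex_minimizer_le[OF A ab(1) sc minV]
    by (simp add: norm_minus_commute inner_diff_right field_simps)
  also have "\<dots> \<le> inner (grad A V a - grad A U a) (a - b)"
    using grad_minimizer_nonneg[OF A ab(2) U minU] by (simp add: inner_diff_left inner_diff_right)
  also have "\<dots> \<le> norm (grad A V a - grad A U a) * norm (a - b)"
    by (rule norm_cauchy_schwarz)
  finally show ?thesis using False by (simp add: power2_eq_square)
qed simp

section \<open>Total variation and risk measures\<close>

lemma (in prob_space) norm_integral_le_const:
  fixes f :: "'a \<Rightarrow> 'b::{banach, second_countable_topology}"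
  assumes f: "f \<in> borel_measurable M" and le: "\<And>x. x \<in> space M \<Longrightarrow> norm (f x) \<le> C"
  shows "norm (LINT x|M. f x) \<le> C"
proof -
  have "integrable M f" using le by (intro integrable_const_bound[of _ C] f) auto
  then have "(LINT x|M. norm (f x)) \<le> (LINT x|M. C)"
    using le by (intro integral_mono) auto
  then have "norm (LINT x|M. f x) \<le> (LINT x|M. C)"
    using integral_norm_bound by (rule order_trans[rotated])
  then show ?thesis by (simp add: prob_space)
qed

lemma abs_integral_diff_le_dTV:
  fixes h :: "'w \<Rightarrow> real"
  assumes P: "prob_space P" and Q: "prob_space Q" and PQ: "sets Q = sets P"
    and h: "h \<in> borel_measurable P" and C: "\<And>x. x \<in> space P \<Longrightarrow> \<bar>h x\<bar> \<le> C"
  shows "\<bar>(LINT x|P. h x) - (LINT x|Q. h x)\<bar> \<le> 2 * C * dTV P Q"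
proof -
  interpret P: prob_space P by fact
  interpret Q: prob_space Q by fact
  have sp: "space Q = space P" by (rule sets_eq_imp_space_eq[OF PQ])
  let ?H = "{h :: 'w \<Rightarrow> real. h \<in> borel_measurable P \<and> (\<forall>x\<in>space P. \<bar>h x\<bar> \<le> 1)}"
  let ?F = "\<lambda>h :: 'w \<Rightarrow> real. \<bar>(LINT x|P. h x) - (LINT x|Q. h x)\<bar>"
  obtain x0 where "x0 \<in> space P" using P.not_empty by blast
  then have C0: "0 \<le> C" using C[of x0] by linarith
  have meas_Q: "k \<in> borel_measurable Q" if "k \<in> borel_measurable P" for k :: "'w \<Rightarrow> real"
    using that measurable_cong_sets[OF PQ refl] by blast
  \<comment> \<open>A real supremum dominates its members only if the set is bounded above; here
    each of the two integrals has absolute value at most 1.\<close>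
  have bdd: "bdd_above (?F ` ?H)"
  proof (rule bdd_aboveI2)
    fix k assume k: "k \<in> ?H"
    have "norm (LINT x|P. k x) \<le> 1"
      using k by (intro P.norm_integral_le_const) auto
    moreover have "norm (LINT x|Q. k x) \<le> 1"
    proof (rule Q.norm_integral_le_const)
      show "k \<in> borel_measurable Q" using k by (intro meas_Q) simp
      show "norm (k x) \<le> 1" if "x \<in> space Q" for x using that k unfolding sp by simp
    qed
    ultimately show "?F k \<le> 2" by simp
  qed
  show ?thesis
  proof (cases "C = 0")
    case True
    then have "(LINT x|P. h x) = 0" "(LINT x|Q. h x) = 0"
      using C sp by (auto intro!: integral_eq_zero_AE AE_I2)
    then show ?thesis using True by simp
  next
    case False
    with C0 have C: "0 < C" "\<And>x. x \<in> space P \<Longrightarrow> \<bar>h x / C\<bar> \<le> 1" using C by auto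
    have "?F (\<lambda>x. h x / C) \<le> (SUP h\<in>?H. ?F h)"
      using h C by (intro cSUP_upper bdd) auto
    then have "\<bar>((LINT x|P. h x) - (LINT x|Q. h x)) / C\<bar> \<le> 2 * dTV P Q"
      by (simp add: dTV_def diff_divide_distrib)
    then show ?thesis using C(1) by (simp add: abs_divide field_simps)
  qed
qed

text \<open>Testing against the difference \<open>u\<close> of the two integrals reduces this to the
  scalar case with bound \<open>C * norm u\<close>. A coordinatewise argument would cost a factor
  depending on the dimension.\<close>

lemma norm_integral_diff_le_dTV:
  fixes g :: "'w \<Rightarrow> 'a::euclidean_space"
  assumes P: "prob_space P" and Q: "prob_space Q" and PQ: "sets Q = sets P"
    and g: "g \<in> borel_measurable P" and C: "\<And>x. x \<in> space P \<Longrightarrow> norm (g x) \<le> C"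
  shows "norm ((LINT x|P. g x) - (LINT x|Q. g x)) \<le> 2 * C * dTV P Q"
proof -
  interpret P: prob_space P by fact
  interpret Q: prob_space Q by fact
  have sp: "space Q = space P" by (rule sets_eq_imp_space_eq[OF PQ])
  have gQ: "g \<in> borel_measurable Q" using g measurable_cong_sets[OF PQ refl] by blast
  have int: "integrable P g" "integrable Q g"
    using g gQ C sp by (auto intro!: P.integrable_const_bound[of _ C] Q.integrable_const_bound[of _ C])
  define u where "u = (LINT x|P. g x) - (LINT x|Q. g x)"
  have "norm u * norm u = inner u u" by (simp add: power2_norm_eq_inner flip: power2_eq_square)
  also have "\<dots> = (LINT x|P. inner (g x) u) - (LINT x|Q. inner (g x) u)"
    using int by (subst (1) u_def) (simp add: inner_diff_left)
  also have "\<dots> \<le> 2 * (C * norm u) * dTV P Q"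
  proof (intro order_trans[OF abs_ge_self abs_integral_diff_le_dTV[OF P Q PQ]])
    show "\<bar>inner (g x) u\<bar> \<le> C * norm u" if "x \<in> space P" for x
      using Cauchy_Schwarz_ineq2 mult_right_mono[OF C[OF that] norm_ge_zero] by (rule order_trans)
  qed (use g in measurable)
  also have "\<dots> = (2 * C * dTV P Q) * norm u" by simp
  finally have *: "norm u * norm u \<le> (2 * C * dTV P Q) * norm u" .
  have "0 \<le> 2 * C * dTV P Q"
  proof -
    obtain x where "x \<in> space P" using P.not_empty by blast
    then have "0 \<le> C" using C[of x] norm_ge_zero[of "g x"] by linarith
    then have "\<bar>(LINT x|P. C) - (LINT x|Q. C)\<bar> \<le> 2 * C * dTV P Q"
      by (intro abs_integral_diff_le_dTV[OF P Q PQ]) auto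
    then show ?thesis by linarith
  qed
  then have "norm u \<le> 2 * C * dTV P Q" using * by (cases "u = 0") auto
  then show ?thesis by (simp add: u_def)
qed

section \<open>Consequences of monotonicity, cash invariance and convexity\<close>

lemma risk_const: "prob_space P \<Longrightarrow> risk vrho P (\<lambda>_. c) = vrho (return borel c)"
proof -
  assume "prob_space P"
  then interpret prob_space P .
  have "distr P borel (\<lambda>_. c) = return borel c"
    by (rule measure_eqI) (auto simp: emeasure_distr emeasure_space_1 indicator_def)
  then show ?thesis by (simp add: risk_def)
qed

lemma bounded_lossI:
  assumes "X \<in> borel_measurable P" "\<And>w. w \<in> space P \<Longrightarrow> \<bar>X w\<bar> \<le> b"
  shows "bounded_loss P X"
  using assms by (auto simp: bounded_loss_def bounded_iff)

lemma bounded_lossE: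
  assumes "bounded_loss P X"
  obtains b where "\<And>w. w \<in> space P \<Longrightarrow> \<bar>X w\<bar> \<le> b"
  using assms by (auto simp: bounded_loss_def bounded_iff)

lemma risk_measure_le_add:
  assumes rho: "risk_measure P rho" and X: "bounded_loss P X" and Y: "bounded_loss P Y"
    and le: "\<And>w. w \<in> space P \<Longrightarrow> X w \<le> Y w + c"
  shows "rho X \<le> rho Y + c"
proof -
  have "bounded_loss P (\<lambda>w. Y w + c)"
  proof -
    obtain b where b: "\<And>w. w \<in> space P \<Longrightarrow> \<bar>Y w\<bar> \<le> b"
      using bounded_lossE[OF Y] by blast
    show ?thesis
    proof (rule bounded_lossI)
      show "\<bar>Y w + c\<bar> \<le> b + \<bar>c\<bar>" if "w \<in> space P" for w using b[OF that] by linarith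
    qed (use Y in \<open>auto simp: bounded_loss_def intro!: borel_measurable_add\<close>)
  qed
  then have "rho X \<le> rho (\<lambda>w. Y w + c)"
    using rho X le unfolding risk_measure_def by (auto intro: AE_I2)
  also have "\<dots> = rho Y + c" using rho Y unfolding risk_measure_def by blast
  finally show ?thesis .
qed

lemma abs_risk_diff_le:
  assumes rho: "risk_measure P rho" and X: "bounded_loss P X" and Y: "bounded_loss P Y"
    and le: "\<And>w. w \<in> space P \<Longrightarrow> \<bar>X w - Y w\<bar> \<le> c"
  shows "\<bar>rho X - rho Y\<bar> \<le> c"
proof -
  have "rho X \<le> rho Y + c" using le by (intro risk_measure_le_add[OF rho X Y]) (force simp: abs_le_iff)
  moreover have "rho Y \<le> rho X + c" using le by (intro risk_measure_le_add[OF rho Y X]) (force simp: abs_le_iff)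
  ultimately show ?thesis by (simp add: abs_le_iff)
qed

text \<open>Comparison with the zero loss. Its risk need not be 0, but it depends only on the law,
  hence not on \<open>P\<close>, which makes the bound uniform in the distribution.\<close>

lemma abs_risk_le:
  assumes P: "prob_space P" and rho: "risk_measure P (risk vrho P)"
    and X: "X \<in> borel_measurable P" and le: "\<And>w. w \<in> space P \<Longrightarrow> \<bar>X w\<bar> \<le> b"
  shows "\<bar>risk vrho P X\<bar> \<le> b + \<bar>vrho (return borel 0)\<bar>"
proof -
  have "\<bar>risk vrho P X - risk vrho P (\<lambda>_. 0)\<bar> \<le> b"
    by (rule abs_risk_diff_le[OF rho]) (use X le in \<open>auto intro: bounded_lossI[of _ _ b] bounded_lossI[of _ _ 0]\<close>)
  then show ?thesis by (simp add: risk_const[OF P])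
qed

text \<open>Under a Dirac mass every loss has the law of a constant, and cash invariance computes
  the risk of a constant from that of the zero loss.\<close>

lemma risk_return:
  assumes rho: "risk_measure (return N z) (risk vrho (return N z))"
    and z: "z \<in> space N" and X: "X \<in> borel_measurable N"
  shows "risk vrho (return N z) X = X z + vrho (return borel 0)"
proof -
  have P: "prob_space (return N z)" using z by (rule prob_space_return)
  have "risk vrho (return N z) X = vrho (return borel (X z))"
    using X z by (simp add: risk_def distr_return)
  also have "\<dots> = risk vrho (return N z) (\<lambda>_. 0 + X z)" by (simp add: risk_const[OF P])
  also have "\<dots> = risk vrho (return N z) (\<lambda>_. 0) + X z"
  proof -
    have "bounded_loss (return N z) (\<lambda>_. 0)" by (rule bounded_lossI[of _ _ 0]) auto
    moreover have "\<forall>X m. bounded_loss (return N z) X \<longrightarrow>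
        risk vrho (return N z) (\<lambda>w. X w + m) = risk vrho (return N z) X + m"
      using rho by (simp add: risk_measure_def)
    ultimately show ?thesis by (meson spec mp)
  qed
  also have "\<dots> = X z + vrho (return borel 0)" by (simp add: risk_const[OF P])
  finally show ?thesis .
qed

text \<open>The gap \<open>m\<close> in the strong convexity inequality does not depend on the
  outcome \<open>w\<close>. Monotonicity and cash invariance carry it through the risk measure
  unchanged, so the modulus \<open>M\<close> survives both risk layers.\<close>

lemma strongly_convex_on_risk:
  assumes rho: "convex_risk_measure P rho" and A: "convex A"
    and l: "\<And>a. a \<in> A \<Longrightarrow> bounded_loss P (l a)"
    and sc: "\<And>w. w \<in> space P \<Longrightarrow> strongly_convex_on M A (\<lambda>a. l a w)"
  shows "strongly_convex_on M A (\<lambda>a. rho (l a))"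
  unfolding strongly_convex_on_def
proof (intro ballI)
  fix x y and u :: real assume xy: "x \<in> A" "y \<in> A" and u: "u \<in> {0..1}"
  define m where "m = M / 2 * u * (1 - u) * (norm (x - y))\<^sup>2"
  have rm: "risk_measure P rho" using rho by (simp add: convex_risk_measure_def)
  have xyA: "u *\<^sub>R x + (1 - u) *\<^sub>R y \<in> A" using A xy u by (intro convexD) auto
  obtain bx "by" where b: "\<And>w. w \<in> space P \<Longrightarrow> \<bar>l x w\<bar> \<le> bx" "\<And>w. w \<in> space P \<Longrightarrow> \<bar>l y w\<bar> \<le> by"
    using bounded_lossE[OF l[OF xy(1)]] bounded_lossE[OF l[OF xy(2)]] by metis
  have "\<bar>u * l x w + (1 - u) * l y w\<bar> \<le> bx + by" if w: "w \<in> space P" for w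
  proof -
    have "\<bar>u * l x w\<bar> \<le> 1 * bx" "\<bar>(1 - u) * l y w\<bar> \<le> 1 * by"
      using u mult_mono[of "\<bar>u\<bar>" 1, OF _ b(1)[OF w]] mult_mono[of "\<bar>1 - u\<bar>" 1, OF _ b(2)[OF w]]
      by (simp_all add: abs_mult)
    then show ?thesis by linarith
  qed
  then have comb: "bounded_loss P (\<lambda>w. u * l x w + (1 - u) * l y w)"
    using l xy by (intro bounded_lossI[where b = "bx + by"])
      (auto simp: bounded_loss_def intro!: borel_measurable_add borel_measurable_times)
  have "rho (l (u *\<^sub>R x + (1 - u) *\<^sub>R y)) \<le> rho (\<lambda>w. u * l x w + (1 - u) * l y w) + (- m)"
  proof (rule risk_measure_le_add[OF rm l[OF xyA] comb])
    fix w assume "w \<in> space P"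
    then have "l (u *\<^sub>R x + (1 - u) *\<^sub>R y) w \<le> u * l x w + (1 - u) * l y w - m"
      unfolding m_def using sc xy u unfolding strongly_convex_on_def by blast
    then show "l (u *\<^sub>R x + (1 - u) *\<^sub>R y) w \<le> u * l x w + (1 - u) * l y w + - m" by simp
  qed
  also have "rho (\<lambda>w. u * l x w + (1 - u) * l y w) \<le> u * rho (l x) + (1 - u) * rho (l y)"
    using rho u l xy unfolding convex_risk_measure_def by blast
  finally show "rho (l (u *\<^sub>R x + (1 - u) *\<^sub>R y)) \<le> u * rho (l x) + (1 - u) * rho (l y)
      - M / 2 * u * (1 - u) * (norm (x - y))\<^sup>2" by (simp add: m_def)
qed

section \<open>Nonnegative matrices of spectral radius below one\<close>

text \<open>For a suitable \<open>c > 1\<close> the powers of \<open>B = c A\<close> are bounded, while \<open>c\<^sup>k y \<le> B\<^sup>k y\<close>.\<close>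

lemma subinvariant_vector_eq_0:
  fixes A :: "real mat" and y :: "nat \<Rightarrow> real"
  assumes A: "A \<in> carrier_mat n n"
    and nonneg: "\<And>i j. i < n \<Longrightarrow> j < n \<Longrightarrow> 0 \<le> A $$ (i, j)"
    and rad: "spectral_radius (map_mat complex_of_real A) < 1"
    and y0: "\<And>i. i < n \<Longrightarrow> 0 \<le> y i"
    and y: "\<And>i. i < n \<Longrightarrow> y i \<le> (\<Sum>j<n. A $$ (i, j) * y j)"
    and i: "i < n"
  shows "y i = 0"
proof -
  let ?A = "map_mat complex_of_real A"
  define \<rho> where "\<rho> = spectral_radius ?A"
  have cA: "?A \<in> carrier_mat n n" using A by simp
  have \<rho>0: "0 \<le> \<rho>" using spectral_radius_mem_max(1)[OF cA] i by (auto simp: \<rho>_def)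
  \<comment> \<open>The factor must exceed 1 and still leave \<open>c * \<rho> < 1\<close>; this
    choice gives \<open>c * \<rho> = 2 * \<rho> / (1 + \<rho>)\<close>.\<close>
  define c where "c = 2 / (1 + \<rho>)"
  have c1: "c > 1" and c\<rho>: "c * \<rho> < 1" using \<rho>0 rad by (auto simp: c_def \<rho>_def field_simps)
  define B where "B = c \<cdot>\<^sub>m A"
  have B: "B \<in> carrier_mat n n" using A by (simp add: B_def)
  have cB: "map_mat complex_of_real B \<in> carrier_mat n n" using B by simp
  have radB: "spectral_radius (map_mat complex_of_real B) < 1"
  proof -
    obtain k where k: "k \<in> spectrum (map_mat complex_of_real B)"
      and rk: "spectral_radius (map_mat complex_of_real B) = norm k"
      using spectral_radius_mem_max(1)[OF cB] i by auto
    obtain v where v: "v \<in> carrier_vec n" "v \<noteq> 0\<^sub>v n" "map_mat complex_of_real B *\<^sub>v v = k \<cdot>\<^sub>v v"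
      using k B by (auto simp: spectrum_def eigenvalue_def eigenvector_def)
    have "?A *\<^sub>v v = (k / c) \<cdot>\<^sub>v v"
    proof -
      have "map_mat complex_of_real B = of_real c \<cdot>\<^sub>m ?A" using A by (auto simp: B_def)
      then have "of_real c \<cdot>\<^sub>v (?A *\<^sub>v v) = k \<cdot>\<^sub>v v"
        using v cA by (intro eq_vecI) (auto simp flip: v(3))
      then have "(1 / complex_of_real c) \<cdot>\<^sub>v (of_real c \<cdot>\<^sub>v (?A *\<^sub>v v)) = (1 / complex_of_real c) \<cdot>\<^sub>v (k \<cdot>\<^sub>v v)" by simp
      moreover have "complex_of_real c \<noteq> 0" using c1 by simp
      ultimately show ?thesis using c1 by (simp add: smult_smult_assoc)
    qed
    then have "k / c \<in> spectrum ?A"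
      using v A by (auto simp: spectrum_def eigenvalue_def eigenvector_def)
    then have "norm (k / c) \<le> \<rho>"
      using spectral_radius_mem_max(2)[OF cA] i by (auto simp: \<rho>_def)
    then have "norm k \<le> c * \<rho>" using c1 by (simp add: norm_divide field_simps)
    then show ?thesis using rk c\<rho> by simp
  qed
  \<comment> \<open>The Jordan normal form provides a bound on the entries of all powers at once,
    because the spectral radius of \<open>B\<close> is strictly below 1.\<close>
  obtain C where C: "\<And>k. norm_bound (map_mat complex_of_real B ^\<^sub>m k) C"
    using spectral_radius_jnf_norm_bound_less_1[OF cB radB] jordan_nf_exists[OF cB]
      char_poly_factorized[OF cB] by blast
  have pow: "map_mat complex_of_real B ^\<^sub>m k = map_mat complex_of_real (B ^\<^sub>m k)" for k
    using of_real_hom.mat_hom_pow[OF B] by metis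
  have Bk: "B ^\<^sub>m k \<in> carrier_mat n n" for k using B by simp
  have bound: "\<bar>(B ^\<^sub>m k) $$ (i, j)\<bar> \<le> C" if "i < n" "j < n" for i j k
    using C[of k] that B Bk[of k] unfolding pow norm_bound_def by (auto split: if_splits)
  have Bnn: "0 \<le> B $$ (i, j)" if "i < n" "j < n" for i j
    using nonneg[OF that] A that c1 by (simp add: B_def)
  have mult: "(B ^\<^sub>m Suc k) $$ (i, j) = (\<Sum>l<n. (B ^\<^sub>m k) $$ (i, l) * B $$ (l, j))" if "i < n" "j < n" for i j k
    using that B Bk[of k] by (auto simp: scalar_prod_def atLeast0LessThan intro!: sum.cong)
  have Bknn: "0 \<le> (B ^\<^sub>m k) $$ (i, j)" if "i < n" "j < n" for i j k
    using that
  proof (induction k arbitrary: i j)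
    case (Suc k)
    then show ?case unfolding mult[OF Suc.prems] by (intro sum_nonneg mult_nonneg_nonneg Bnn) auto
  qed (use B in auto)
  have iter: "c ^ k * y i \<le> (\<Sum>j<n. (B ^\<^sub>m k) $$ (i, j) * y j)" if "i < n" for i k
    using that
  proof (induction k arbitrary: i)
    case 0
    have "(\<Sum>j<n. (B ^\<^sub>m 0) $$ (i, j) * y j) = (\<Sum>j<n. if j = i then y j else 0)"
      using 0 B by (intro sum.cong) auto
    then show ?case using 0 by simp
  next
    case (Suc k)
    have "c ^ Suc k * y i = c * (c ^ k * y i)" by simp
    also have "\<dots> \<le> c * (\<Sum>l<n. (B ^\<^sub>m k) $$ (i, l) * y l)"
      using Suc c1 by (intro mult_left_mono) auto
    also have "\<dots> = (\<Sum>l<n. (B ^\<^sub>m k) $$ (i, l) * (c * y l))"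
      by (simp add: sum_distrib_left mult.left_commute)
    also have "\<dots> \<le> (\<Sum>l<n. (B ^\<^sub>m k) $$ (i, l) * (\<Sum>j<n. B $$ (l, j) * y j))"
    proof (intro sum_mono mult_left_mono Bknn)
      fix l assume l: "l \<in> {..<n}"
      then have "c * y l \<le> c * (\<Sum>j<n. A $$ (l, j) * y j)" using y c1 by (intro mult_left_mono) auto
      also have "\<dots> = (\<Sum>j<n. B $$ (l, j) * y j)"
        using l A by (auto simp: B_def sum_distrib_left mult.assoc intro!: sum.cong)
      finally show "c * y l \<le> (\<Sum>j<n. B $$ (l, j) * y j)" .
    qed (use Suc in auto)
    also have "\<dots> = (\<Sum>j<n. \<Sum>l<n. (B ^\<^sub>m k) $$ (i, l) * (B $$ (l, j) * y j))"
      unfolding sum_distrib_left by (rule sum.swap)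
    also have "\<dots> = (\<Sum>j<n. (B ^\<^sub>m Suc k) $$ (i, j) * y j)"
      using Suc by (intro sum.cong refl) (subst mult, auto simp: sum_distrib_right mult.assoc)
    finally show ?case .
  qed
  show ?thesis
  proof (rule ccontr)
    assume "y i \<noteq> 0"
    then have pos: "y i > 0" using y0[OF i] by simp
    define S where "S = (\<Sum>j<n. C * y j)"
    \<comment> \<open>\<open>c ^ k * y i\<close> stays below \<open>S\<close> for every
      \<open>k\<close>, whereas \<open>c ^ k\<close> grows without bound.\<close>
    obtain k where k: "S / y i < c ^ k" using real_arch_pow[OF c1] by blast
    have "c ^ k * y i \<le> (\<Sum>j<n. (B ^\<^sub>m k) $$ (i, j) * y j)" by (rule iter[OF i])
    also have "\<dots> \<le> S" unfolding S_def
      using bound[OF i] y0 by (intro sum_mono mult_right_mono) (auto simp: abs_le_iff)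
    finally show False using k pos by (simp add: field_simps)
  qed
qed

text \<open>Everything rests on the sign principle \<open>nonpos\<close>: x \<le> A x forces x \<le>
  0. It is applied to the negated columns of \<open>R\<close>, which gives nonnegative entries, and
  to x - R d, which gives the bound. Proving 1 - A invertible first makes the choice by
  \<open>the\<close> legitimate.\<close>

lemma nonneg_resolvent:
  fixes A R :: "real mat"
  assumes A: "A \<in> carrier_mat n n"
    and nonneg: "\<And>i j. i < n \<Longrightarrow> j < n \<Longrightarrow> 0 \<le> A $$ (i, j)"
    and rad: "spectral_radius (map_mat complex_of_real A) < 1"
    and R: "R = the (mat_inverse (1\<^sub>m n - A))"
  shows "\<And>i j. i < n \<Longrightarrow> j < n \<Longrightarrow> 0 \<le> R $$ (i, j)"
    and "\<And>i. i < n \<Longrightarrow> 1 \<le> R $$ (i, i)"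
    and "\<And>x d i. (\<And>i. i < n \<Longrightarrow> x i \<le> (\<Sum>j<n. A $$ (i, j) * x j) + d i) \<Longrightarrow> i < n \<Longrightarrow>
           x i \<le> (\<Sum>j<n. R $$ (i, j) * d j)"
proof -
  have zero: "y i = 0"
    if "\<And>i. i < n \<Longrightarrow> 0 \<le> y i" "\<And>i. i < n \<Longrightarrow> y i \<le> (\<Sum>j<n. A $$ (i, j) * y j)" "i < n" for y i
    by (rule subinvariant_vector_eq_0[OF A nonneg rad]) (use that in auto)
  have nonpos: "x i \<le> 0"
    if x: "\<And>i. i < n \<Longrightarrow> x i \<le> (\<Sum>j<n. A $$ (i, j) * x j)" and i: "i < n" for x i
  proof -
    \<comment> \<open>As \<open>A\<close> is nonnegative, the positive part of \<open>x\<close>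
      inherits the inequality x \<le> A x, and it is a nonnegative vector to which
      \<open>zero\<close> applies.\<close>
    have "max 0 (x i) = 0"
    proof (rule zero[OF _ _ i])
      fix i assume i: "i < n"
      have "x i \<le> (\<Sum>j<n. A $$ (i, j) * max 0 (x j))"
        using x[OF i] by (rule order_trans) (intro sum_mono mult_left_mono nonneg i, auto)
      moreover have "0 \<le> (\<Sum>j<n. A $$ (i, j) * max 0 (x j))"
        using i by (intro sum_nonneg mult_nonneg_nonneg nonneg) auto
      ultimately show "max 0 (x i) \<le> (\<Sum>j<n. A $$ (i, j) * max 0 (x j))" by simp
    qed auto
    then show ?thesis by simp
  qed
  let ?M = "1\<^sub>m n - A"
  have M: "?M \<in> carrier_mat n n" using A by (simp add: minus_carrier_mat)
  have "det ?M \<noteq> 0"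
  proof
    assume "det ?M = 0"
    then obtain v where v: "v \<in> carrier_vec n" "v \<noteq> 0\<^sub>v n" "?M *\<^sub>v v = 0\<^sub>v n"
      using det_0_iff_vec_prod_zero[OF M] by blast
    have eq: "v $ i = (\<Sum>j<n. A $$ (i, j) * v $ j)" if i: "i < n" for i
    proof -
      have "(?M *\<^sub>v v) $ i = (\<Sum>j<n. (if i = j then v $ j else 0) - A $$ (i, j) * v $ j)"
        using i A v(1) by (auto simp: scalar_prod_def atLeast0LessThan left_diff_distrib intro!: sum.cong)
      also have "\<dots> = v $ i - (\<Sum>j<n. A $$ (i, j) * v $ j)" using i by (simp add: sum_subtractf)
      finally show ?thesis using v(3) i by simp
    qed
    \<comment> \<open>A kernel vector satisfies v = A v, so by the triangle inequality its entrywise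
      absolute value is subinvariant.\<close>
    have "\<bar>v $ i\<bar> = 0" if i: "i < n" for i
    proof (rule zero[OF _ _ i])
      fix i assume i: "i < n"
      have "\<bar>v $ i\<bar> \<le> (\<Sum>j<n. \<bar>A $$ (i, j) * v $ j\<bar>)"
        by (subst eq[OF i]) (rule sum_abs)
      also have "\<dots> = (\<Sum>j<n. A $$ (i, j) * \<bar>v $ j\<bar>)"
        using nonneg i by (intro sum.cong) (auto simp: abs_mult)
      finally show "\<bar>v $ i\<bar> \<le> (\<Sum>j<n. A $$ (i, j) * \<bar>v $ j\<bar>)" .
    qed simp
    then have "v = 0\<^sub>v n" using v(1) by (intro eq_vecI) auto
    then show False using v(2) by simp
  qed
  then have "?M \<in> Units (ring_mat TYPE(real) n ())" by (rule det_non_zero_imp_unit[OF M])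
  then have "mat_inverse ?M = Some R"
    using mat_inverse(1)[OF M, of "()"] R by (cases "mat_inverse ?M") auto
  from mat_inverse(2)[OF M this] have inv: "?M * R = 1\<^sub>m n" "R * ?M = 1\<^sub>m n" and Rc: "R \<in> carrier_mat n n"
    by auto
  \<comment> \<open>The equation R = 1 + A R, read off from (1 - A) R = 1. Since A R is nonnegative,
    it also gives the diagonal bound below.\<close>
  have R_eq: "R $$ (i, k) = (if i = k then 1 else 0) + (\<Sum>j<n. A $$ (i, j) * R $$ (j, k))"
    if i: "i < n" and k: "k < n" for i k
  proof -
    have "(?M * R) $$ (i, k) = (\<Sum>j<n. (if i = j then R $$ (j, k) else 0) - A $$ (i, j) * R $$ (j, k))"
      using i k A Rc by (auto simp: scalar_prod_def atLeast0LessThan left_diff_distrib intro!: sum.cong)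
    also have "\<dots> = R $$ (i, k) - (\<Sum>j<n. A $$ (i, j) * R $$ (j, k))" using i by (simp add: sum_subtractf)
    finally show ?thesis using inv(1) i k by simp
  qed
  show Rnn: "0 \<le> R $$ (i, k)" if i: "i < n" and k: "k < n" for i k
  proof -
    have "- R $$ (i, k) \<le> 0"
    proof (rule nonpos[OF _ i])
      fix i assume "i < n"
      then show "- R $$ (i, k) \<le> (\<Sum>j<n. A $$ (i, j) * - R $$ (j, k))"
        using R_eq[of i k] k by (simp add: sum_negf)
    qed
    then show ?thesis by simp
  qed
  show "1 \<le> R $$ (i, i)" if i: "i < n" for i
  proof -
    have "0 \<le> (\<Sum>j<n. A $$ (i, j) * R $$ (j, i))" using i Rnn nonneg by (intro sum_nonneg) auto
    then show ?thesis using R_eq[OF i i] by simp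
  qed
  show "x i \<le> (\<Sum>j<n. R $$ (i, j) * d j)"
    if x: "\<And>i. i < n \<Longrightarrow> x i \<le> (\<Sum>j<n. A $$ (i, j) * x j) + d i" and i: "i < n" for x d i
  proof -
    have "x i - (\<Sum>j<n. R $$ (i, j) * d j) \<le> 0"
    proof (rule nonpos[OF _ i])
      fix i assume i: "i < n"
      have "(\<Sum>k<n. R $$ (i, k) * d k)
          = (\<Sum>k<n. (if i = k then d k else 0) + (\<Sum>j<n. A $$ (i, j) * R $$ (j, k) * d k))"
        using i by (intro sum.cong refl) (subst R_eq, auto simp: distrib_right sum_distrib_right)
      also have "\<dots> = d i + (\<Sum>j<n. \<Sum>k<n. A $$ (i, j) * R $$ (j, k) * d k)"
        using i by (subst sum.distrib, subst sum.swap) simp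
      also have "(\<Sum>j<n. \<Sum>k<n. A $$ (i, j) * R $$ (j, k) * d k) = (\<Sum>j<n. A $$ (i, j) * (\<Sum>k<n. R $$ (j, k) * d k))"
        by (simp add: sum_distrib_left mult.assoc)
      finally show "x i - (\<Sum>j<n. R $$ (i, j) * d j) \<le> (\<Sum>j<n. A $$ (i, j) * (x j - (\<Sum>k<n. R $$ (j, k) * d k)))"
        using x[OF i] by (simp add: right_diff_distrib sum_subtractf)
    qed
    then show ?thesis by simp
  qed
qed

section \<open>Games with strongly convex losses\<close>

text \<open>An extensional box is a full product over all indices, with the singleton
  \<open>{undefined}\<close> outside \<open>J\<close>; Tychonoff's theorem then applies in the
  product topology.\<close>

lemma compact_PiE:
  fixes S :: "'i \<Rightarrow> 'a::topological_space set"
  assumes "\<And>j. j \<in> J \<Longrightarrow> compact (S j)"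
  shows "compact (PiE J S)"
proof -
  have eq: "PiE J S = PiE UNIV (\<lambda>j. if j \<in> J then S j else {undefined})"
    by (auto simp: PiE_iff extensional_def split: if_splits)
  have "compactin (product_topology (\<lambda>_. euclidean) UNIV) (PiE J S)"
    unfolding eq by (subst compactin_PiE) (use assms in auto)
  then show ?thesis by (simp add: euclidean_product_topology)
qed

text \<open>Indices outside \<open>J\<close> are included so that a whole profile can later be
  checked coordinate by coordinate; by extensionality such a component is constant.\<close>

lemma component_measurable_borel:
  fixes T :: "'i \<Rightarrow> 'b::topological_space set"
  shows "(\<lambda>\<xi>. \<xi> j) \<in> borel_measurable (PiM J (\<lambda>j. restrict_space borel (T j)))"
proof (cases "j \<in> J")
  case True
  have "(\<lambda>\<xi>. \<xi> j) \<in> PiM J (\<lambda>j. restrict_space borel (T j)) \<rightarrow>\<^sub>M restrict_space borel (T j)"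
    using True by measurable
  then show ?thesis by (rule measurable_compose) (rule measurable_restrict_space1, simp)
next
  case False
  then have "\<xi> j = undefined" if "\<xi> \<in> space (PiM J (\<lambda>j. restrict_space borel (T j)))" for \<xi>
    using that by (auto simp: space_PiM PiE_iff extensional_def)
  then show ?thesis by (subst measurable_cong[where g = "\<lambda>_. undefined"]) auto
qed

text \<open>Gathers what gives the objectives a meaning and makes them strongly convex, for any
  belief on the parameters and before any Lipschitz condition enters.\<close>

locale convex_game =
  fixes G :: "('a::euclidean_space, 'b::euclidean_space, 'z::euclidean_space) bayes_game"
    and M :: "nat \<Rightarrow> real"
  assumes game: "bayes_game G"
    and M_pos: "i \<in> Players G \<Longrightarrow> M i > 0"
    and cost_convex: "i \<in> Players G \<Longrightarrow> a \<in> action_profiles G \<Longrightarrow> \<theta> \<in> type_profiles G \<Longrightarrow>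
      strongly_convex_on (M i) (Acts G i) (\<lambda>x. cost G i (a(i := x)) \<theta>)"
    and al_convex: "prob_space (P :: (nat \<Rightarrow> 'b) measure) \<Longrightarrow> convex_risk_measure P (risk (rho_al G) P)"
    and ep_convex: "prob_space (Q :: 'z measure) \<Longrightarrow> convex_risk_measure Q (risk (rho_ep G) Q)"
    and cost_diff: "i \<in> Players G \<Longrightarrow> a \<in> action_profiles G \<Longrightarrow> \<theta> \<in> type_profiles G \<Longrightarrow>
      (\<lambda>x. cost G i (a(i := x)) \<theta>) differentiable_on Acts G i"
begin

lemma Acts: "i \<in> Players G \<Longrightarrow> Acts G i \<noteq> {}" "i \<in> Players G \<Longrightarrow> compact (Acts G i)"
    "i \<in> Players G \<Longrightarrow> convex (Acts G i)"
  and Types: "i \<in> Players G \<Longrightarrow> Types G i \<noteq> {}" "i \<in> Players G \<Longrightarrow> compact (Types G i)"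
  and Params: "Params G \<in> sets borel" "true_param G \<in> Params G"
  and players: "0 < n_players G"
  and cost_continuous: "i \<in> Players G \<Longrightarrow>
        continuous_on (action_profiles G \<times> type_profiles G) (\<lambda>(a, \<theta>). cost G i a \<theta>)"
  using game by (auto simp: bayes_game_def game_spaces_def)

lemma compact_profiles: "compact (action_profiles G)" "compact (type_profiles G)"
  unfolding action_profiles_def type_profiles_def using Acts Types by (auto intro!: compact_PiE)

lemma cost_bounded:
  assumes "i \<in> Players G"
  obtains b where "\<And>a \<theta>. a \<in> action_profiles G \<Longrightarrow> \<theta> \<in> type_profiles G \<Longrightarrow> \<bar>cost G i a \<theta>\<bar> \<le> b"
proof -
  have "bounded ((\<lambda>(a, \<theta>). cost G i a \<theta>) ` (action_profiles G \<times> type_profiles G))"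
    by (intro compact_imp_bounded compact_continuous_image cost_continuous assms compact_Times compact_profiles)
  then obtain b where "\<forall>y\<in>(\<lambda>(a, \<theta>). cost G i a \<theta>) ` (action_profiles G \<times> type_profiles G). norm y \<le> b"
    unfolding bounded_iff by blast
  then have "\<bar>cost G i a \<theta>\<bar> \<le> b" if "a \<in> action_profiles G" "\<theta> \<in> type_profiles G" for a \<theta>
    using that by auto
  then show ?thesis by (rule that)
qed

text \<open>The hypotheses on \<open>cost\<close> vary a player's action by updating a full profile.
  This form of the profile inside \<open>loss\<close> is stable under such updates
  (\<open>joint_upd\<close>), which transfers them to \<open>loss\<close>.\<close>

definition joint :: "nat \<Rightarrow> (nat \<Rightarrow> 'b \<Rightarrow> 'a) \<Rightarrow> 'a \<Rightarrow> (nat \<Rightarrow> 'b) \<Rightarrow> nat \<Rightarrow> 'a" where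
  "joint i f a \<xi> = (\<lambda>j\<in>Players G. if j = i then a else f j (\<xi> j))"

lemma strategiesD: "f \<in> strategies G J \<Longrightarrow> j \<in> J \<Longrightarrow> x \<in> Types G j \<Longrightarrow> f j x \<in> Acts G j"
  unfolding strategies_def using measurable_space[of "f j" "restrict_space borel (Types G j)"]
  by (fastforce simp: space_restrict_space)

lemma strategies_others: "f \<in> strategies G (Players G) \<Longrightarrow> f \<in> strategies G (others G i)"
  by (auto simp: strategies_def)

lemma joint_in_profiles:
  "i \<in> Players G \<Longrightarrow> f \<in> strategies G (others G i) \<Longrightarrow> a \<in> Acts G i \<Longrightarrow> \<xi> \<in> opp_types G i \<Longrightarrow>
    joint i f a \<xi> \<in> action_profiles G"
  unfolding joint_def action_profiles_def opp_types_def by (auto simp: PiE_iff intro!: strategiesD)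

lemma upd_in_profiles:
  "i \<in> Players G \<Longrightarrow> x \<in> Types G i \<Longrightarrow> \<xi> \<in> opp_types G i \<Longrightarrow> \<xi>(i := x) \<in> type_profiles G"
  unfolding type_profiles_def opp_types_def by (auto simp: PiE_iff extensional_def)

lemma joint_self: "i \<in> Players G \<Longrightarrow> joint i f a \<xi> i = a"
  and joint_upd: "i \<in> Players G \<Longrightarrow> (joint i f a \<xi>)(i := y) = joint i f y \<xi>"
  by (auto simp: joint_def)

lemma loss_joint: "loss G i f x a \<xi> = cost G i (joint i f a \<xi>) (\<xi>(i := x))"
  by (simp add: loss_def joint_def)

lemma opp_types_nonempty: "opp_types G i \<noteq> {}"
  unfolding opp_types_def using Types by (auto simp: PiE_eq_empty_iff)

lemma space_types: "space (types_space G (others G i)) = opp_types G i"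
    "space (types_space G (Players G)) = type_profiles G"
  by (auto simp: types_space_def opp_types_def type_profiles_def space_PiM space_restrict_space)

lemma cond_prob:
  assumes "i \<in> Players G" "x \<in> Types G i" "z \<in> Params G"
  shows "prob_space (cond G i x z)" "sets (cond G i x z) = sets (types_space G (others G i))"
    "space (cond G i x z) = opp_types G i"
proof -
  have "(\<lambda>x. cond G i x z) \<in> measurable (restrict_space borel (Types G i))
      (prob_algebra (types_space G (others G i)))"
    using game assms by (auto simp: bayes_game_def game_conditionals_def)
  then have "cond G i x z \<in> space (prob_algebra (types_space G (others G i)))"
    by (rule measurable_space) (use assms in \<open>simp add: space_restrict_space\<close>)
  then show "prob_space (cond G i x z)" and s: "sets (cond G i x z) = sets (types_space G (others G i))"
    by (auto simp: space_prob_algebra)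
  show "space (cond G i x z) = opp_types G i"
    using sets_eq_imp_space_eq[OF s] by (simp add: space_types)
qed

text \<open>\<open>cost\<close> is continuous only on the set of profiles, so it is Borel on the
  restricted space. It is composed with the map from opponents' types to full profiles, whose
  measurability is checked in every coordinate, including the constant ones.\<close>

lemma loss_measurable:
  assumes i: "i \<in> Players G" and f: "f \<in> strategies G (others G i)" and x: "x \<in> Types G i" and a: "a \<in> Acts G i"
  shows "loss G i f x a \<in> borel_measurable (types_space G (others G i))"
proof -
  let ?N = "types_space G (others G i)"
  let ?S = "action_profiles G \<times> type_profiles G"
  have comp: "(\<lambda>\<xi>. \<xi> j) \<in> borel_measurable ?N" for j
    unfolding types_space_def by (rule component_measurable_borel)
  have act: "(\<lambda>\<xi>. joint i f a \<xi>) \<in> borel_measurable ?N"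
  proof (rule measurable_coordinatewise_then_product)
    fix j
    show "(\<lambda>\<xi>. joint i f a \<xi> j) \<in> borel_measurable ?N"
    proof (cases "j \<in> others G i")
      case True
      have "f j \<in> borel_measurable (restrict_space borel (Types G j))"
        using f True by (auto simp: strategies_def measurable_restrict_space2_iff)
      moreover have "(\<lambda>\<xi>. \<xi> j) \<in> ?N \<rightarrow>\<^sub>M restrict_space borel (Types G j)"
        unfolding types_space_def using True by measurable
      ultimately have "(\<lambda>\<xi>. f j (\<xi> j)) \<in> borel_measurable ?N" by (rule measurable_compose[rotated])
      then show ?thesis using True by (simp add: joint_def)
    next
      case False
      then consider "j = i" | "j \<notin> Players G" by blast
      then show ?thesis
      proof cases
        case 1
        show ?thesis unfolding 1 joint_self[OF i] by simp
      next
        case 2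
        then have "joint i f a \<xi> j = undefined" for \<xi> by (simp add: joint_def)
        then show ?thesis by simp
      qed
    qed
  qed
  have types: "(\<lambda>\<xi>. \<xi>(i := x)) \<in> borel_measurable ?N"
  proof (rule measurable_coordinatewise_then_product)
    fix j show "(\<lambda>\<xi>. (\<xi>(i := x)) j) \<in> borel_measurable ?N" using comp by (cases "j = i") auto
  qed
  have "(\<lambda>\<xi>. (joint i f a \<xi>, \<xi>(i := x))) \<in> ?N \<rightarrow>\<^sub>M restrict_space borel ?S"
    using joint_in_profiles[OF i f a] upd_in_profiles[OF i x]
    by (intro measurable_restrict_space2 borel_measurable_Pair act types) (auto simp: space_types)
  moreover have "(\<lambda>(a, \<theta>). cost G i a \<theta>) \<in> borel_measurable (restrict_space borel ?S)"
    by (intro borel_measurable_continuous_on_restrict cost_continuous i)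
  ultimately have "(\<lambda>\<xi>. (\<lambda>(a, \<theta>). cost G i a \<theta>) (joint i f a \<xi>, \<xi>(i := x))) \<in> borel_measurable ?N"
    by (rule measurable_compose)
  then show ?thesis by (simp add: loss_joint[abs_def])
qed

context
  fixes i f x
  assumes i: "i \<in> Players G" and f: "f \<in> strategies G (others G i)" and x: "x \<in> Types G i"
begin

lemma loss_measurable_cond: "z \<in> Params G \<Longrightarrow> a \<in> Acts G i \<Longrightarrow> loss G i f x a \<in> borel_measurable (cond G i x z)"
  by (subst measurable_cong_sets[OF cond_prob(2)[OF i x] refl]) (auto intro: loss_measurable[OF i f x])

lemma loss_bounded:
  obtains b where "\<And>a \<xi>. a \<in> Acts G i \<Longrightarrow> \<xi> \<in> opp_types G i \<Longrightarrow> \<bar>loss G i f x a \<xi>\<bar> \<le> b"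
proof -
  obtain b where "\<And>a \<theta>. a \<in> action_profiles G \<Longrightarrow> \<theta> \<in> type_profiles G \<Longrightarrow> \<bar>cost G i a \<theta>\<bar> \<le> b"
    using cost_bounded[OF i] by blast
  then have "\<bar>loss G i f x a \<xi>\<bar> \<le> b" if "a \<in> Acts G i" "\<xi> \<in> opp_types G i" for a \<xi>
    unfolding loss_joint using joint_in_profiles[OF i f that] upd_in_profiles[OF i x that(2)] by blast
  then show ?thesis by (rule that)
qed

lemma bounded_loss_loss: "z \<in> Params G \<Longrightarrow> a \<in> Acts G i \<Longrightarrow> bounded_loss (cond G i x z) (loss G i f x a)"
proof -
  assume z: "z \<in> Params G" and a: "a \<in> Acts G i"
  obtain b where "\<And>\<xi>. \<xi> \<in> opp_types G i \<Longrightarrow> \<bar>loss G i f x a \<xi>\<bar> \<le> b" using loss_bounded a by metis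
  then show ?thesis
    by (intro bounded_lossI[where b = b] loss_measurable_cond z a) (simp add: cond_prob[OF i x z])
qed

lemma loss_diff:
  "a \<in> Acts G i \<Longrightarrow> \<xi> \<in> opp_types G i \<Longrightarrow> (\<lambda>y. loss G i f x y \<xi>) differentiable_on Acts G i"
  using cost_diff[OF i joint_in_profiles[OF i f, of a \<xi>] upd_in_profiles[OF i x, of \<xi>]]
  by (simp add: joint_upd[OF i] loss_joint)

lemma al_risk_convex:
  assumes z: "z \<in> Params G" shows "strongly_convex_on (M i) (Acts G i) (\<lambda>a. al_risk G i f x a z)"
  unfolding al_risk_def
proof (rule strongly_convex_on_risk[of "cond G i x z" "risk (rho_al G) (cond G i x z)" _ "loss G i f x"])
  show "convex_risk_measure (cond G i x z) (risk (rho_al G) (cond G i x z))"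
    by (intro al_convex cond_prob i x z)
  fix \<xi> assume "\<xi> \<in> space (cond G i x z)"
  then have \<xi>: "\<xi> \<in> opp_types G i" by (simp add: cond_prob[OF i x z])
  \<comment> \<open>Any own action completes the base profile, since the update at \<open>i\<close>
    overwrites it.\<close>
  obtain a where a: "a \<in> Acts G i" using Acts(1)[OF i] by blast
  show "strongly_convex_on (M i) (Acts G i) (\<lambda>a. loss G i f x a \<xi>)"
    using cost_convex[OF i joint_in_profiles[OF i f a \<xi>] upd_in_profiles[OF i x \<xi>]]
    by (simp add: joint_upd[OF i] loss_joint)
qed (use z Acts i bounded_loss_loss in auto)

text \<open>The bound is uniform in the parameter as well as in the action: it uses only the bound
  of the loss and the risk of the zero loss. This makes the inner risk an admissible loss for the
  outer risk measure.\<close>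

lemma al_risk_bounded:
  obtains b where "\<And>a z. a \<in> Acts G i \<Longrightarrow> z \<in> Params G \<Longrightarrow> \<bar>al_risk G i f x a z\<bar> \<le> b"
proof -
  obtain b where b: "\<And>a \<xi>. a \<in> Acts G i \<Longrightarrow> \<xi> \<in> opp_types G i \<Longrightarrow> \<bar>loss G i f x a \<xi>\<bar> \<le> b"
    using loss_bounded by blast
  have "\<bar>al_risk G i f x a z\<bar> \<le> b + \<bar>rho_al G (return borel 0)\<bar>" if "a \<in> Acts G i" "z \<in> Params G" for a z
    unfolding al_risk_def
    using that b al_convex cond_prob[OF i x that(2)]
    by (intro abs_risk_le loss_measurable_cond) (auto simp: convex_risk_measure_def)
  then show ?thesis by (rule that)
qed

lemma al_risk_measurable:
  "a \<in> Acts G i \<Longrightarrow> al_risk G i f x a \<in> borel_measurable (restrict_space borel (Params G))"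
  using game i f x by (auto simp: bayes_game_def al_risk_measurable_def)

lemma bounded_loss_al_risk:
  assumes \<mu>: "sets \<mu> = sets (restrict_space borel (Params G))" and a: "a \<in> Acts G i"
  shows "bounded_loss \<mu> (al_risk G i f x a)"
proof -
  have sp: "space \<mu> = Params G" using sets_eq_imp_space_eq[OF \<mu>] by (simp add: space_restrict_space)
  obtain b where "\<And>z. z \<in> Params G \<Longrightarrow> \<bar>al_risk G i f x a z\<bar> \<le> b" using al_risk_bounded a by metis
  moreover have "al_risk G i f x a \<in> borel_measurable \<mu>"
    by (subst measurable_cong_sets[OF \<mu> refl]) (rule al_risk_measurable[OF a])
  ultimately show ?thesis by (intro bounded_lossI[where b = b]) (simp_all add: sp)
qed

lemma objective_convex:
  assumes P: "prob_space \<mu>" and \<mu>: "sets \<mu> = sets (restrict_space borel (Params G))"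
  shows "strongly_convex_on (M i) (Acts G i) (objective G i \<mu> f x)"
proof -
  have sp: "space \<mu> = Params G" using sets_eq_imp_space_eq[OF \<mu>] by (simp add: space_restrict_space)
  show ?thesis
    unfolding objective_def
    by (rule strongly_convex_on_risk[of \<mu> "risk (rho_ep G) \<mu>" _ "al_risk G i f x"])
      (use ep_convex[OF P] Acts(3)[OF i] bounded_loss_al_risk[OF \<mu>] al_risk_convex sp in auto)
qed

end

lemma al_risk_diff_le:
  assumes i: "i \<in> Players G" and f: "f \<in> strategies G (others G i)" and f': "f' \<in> strategies G (others G i)"
    and x: "x \<in> Types G i" and a: "a \<in> Acts G i" and z: "z \<in> Params G"
    and le: "\<And>\<xi>. \<xi> \<in> opp_types G i \<Longrightarrow> \<bar>loss G i f x a \<xi> - loss G i f' x a \<xi>\<bar> \<le> c"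
  shows "\<bar>al_risk G i f x a z - al_risk G i f' x a z\<bar> \<le> c"
proof -
  have "risk_measure (cond G i x z) (risk (rho_al G) (cond G i x z))"
    using al_convex[OF cond_prob(1)[OF i x z]] by (simp add: convex_risk_measure_def)
  from abs_risk_diff_le[OF this bounded_loss_loss[OF i f x z a] bounded_loss_loss[OF i f' x z a]] le
  show ?thesis by (simp add: al_risk_def cond_prob[OF i x z])
qed

section \<open>Posteriors and the Dirac belief as beliefs on the parameter space\<close>

lemma posterior_belief:
  assumes i: "i \<in> Players G" and t: "1 \<le> t" and h: "h \<in> space (histories G t)" and def: "posterior_defined G i t h"
  shows "prob_space (posterior G i t h)"
    "sets (posterior G i t h) = sets (restrict_space borel (Params G))"
proof -
  have beliefs: "sets (ref_params G) = sets (restrict_space borel (Params G))"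
    "prior_dens G i \<in> borel_measurable (ref_params G)"
    and rt: "sets (ref_types G) = sets (types_space G (Players G))"
    and dens: "(\<lambda>(\<theta>, z). dens G \<theta> z) \<in>
        borel_measurable (types_space G (Players G) \<Otimes>\<^sub>M restrict_space borel (Params G))"
    using game i by (auto simp: bayes_game_def game_beliefs_def game_distributions_def)
  show "sets (posterior G i t h) = sets (restrict_space borel (Params G))"
    by (simp add: posterior_def beliefs)
  have h\<tau>: "h \<tau> \<in> space (types_space G (Players G))" if "\<tau> \<in> {1..<t}" for \<tau>
    using h that sets_eq_imp_space_eq[OF rt] by (auto simp: histories_def space_PiM PiE_iff eta_def)
  have "(\<lambda>z. dens G (h \<tau>) z) \<in> borel_measurable (ref_params G)" if "\<tau> \<in> {1..<t}" for \<tau>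
    using measurable_compose[OF measurable_Pair1'[OF h\<tau>[OF that]] dens]
    by (subst measurable_cong_sets[OF beliefs(1) refl]) simp
  then have meas: "posterior_weight G i t h \<in> borel_measurable (ref_params G)"
    unfolding posterior_weight_def using beliefs(2)
    by (intro measurable_compose[OF _ measurable_ennreal] borel_measurable_times borel_measurable_prod)
  show "prob_space (posterior G i t h)"
  proof
    have "emeasure (posterior G i t h) (space (posterior G i t h))
        = (\<integral>\<^sup>+z. posterior_weight G i t h z / evidence G i t h \<partial>ref_params G)"
      unfolding posterior_def using meas by (subst emeasure_density) (auto intro!: nn_integral_cong)
    also have "\<dots> = evidence G i t h / evidence G i t h"
      using meas by (subst nn_integral_divide) (auto simp: evidence_def)
    also have "\<dots> = 1"
      using def by (intro ennreal_divide_self) (auto simp: posterior_defined_def)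
    finally show "emeasure (posterior G i t h) (space (posterior G i t h)) = 1" .
  qed
qed

lemma posteriors_belief:
  assumes "i \<in> Players G" "\<mu> \<in> posteriors G i"
  shows "prob_space \<mu>" "sets \<mu> = sets (restrict_space borel (Params G))"
  using assms posterior_belief by (auto simp: posteriors_def)

lemma true_belief: "prob_space (true_belief G)"
    "sets (true_belief G) = sets (restrict_space borel (Params G))"
  using Params by (auto simp: true_belief_def space_restrict_space intro!: prob_space_return)

lemma objective_true_belief:
  assumes "i \<in> Players G" "f \<in> strategies G (others G i)" "x \<in> Types G i" "a \<in> Acts G i"
  shows "objective G i (true_belief G) f x a = al_risk G i f x a (true_param G) + rho_ep G (return borel 0)"
proof -
  have "risk_measure (true_belief G) (risk (rho_ep G) (true_belief G))"
    using ep_convex[OF true_belief(1)] by (simp add: convex_risk_measure_def)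
  then show ?thesis
    unfolding objective_def true_belief_def
    by (rule risk_return[OF _ _ al_risk_measurable[OF assms]]) (simp add: space_restrict_space Params)
qed

end

section \<open>Stability of equilibria\<close>

text \<open>\<open>Z0 i\<close> is the set of prior probability one that expresses "almost surely"
  in (B3). The suprema in (B4) range over the same set, so that the two Lipschitz conditions can be
  chained.\<close>

locale learning_game = convex_game G M
  for G :: "('a::euclidean_space, 'b::euclidean_space, 'z::euclidean_space) bayes_game" and M +
  fixes kal0 kal1 kep0 kep1 :: "nat \<Rightarrow> real"
    and L0 L1 K :: "nat \<Rightarrow> nat \<Rightarrow> real"
    and Z0 :: "nat \<Rightarrow> 'z set"
    and Gam Inv :: "real mat"
  assumes L_nonneg: "i \<in> Players G \<Longrightarrow> j \<in> others G i \<Longrightarrow> 0 \<le> L0 i j \<and> 0 \<le> L1 i j"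
    and cost_lipschitz: "i \<in> Players G \<Longrightarrow> p \<in> action_profiles G \<Longrightarrow> p' \<in> action_profiles G \<Longrightarrow>
      \<theta> \<in> type_profiles G \<Longrightarrow> p' i = p i \<Longrightarrow>
      \<bar>cost G i p' \<theta> - cost G i p \<theta>\<bar> \<le> (\<Sum>j\<in>others G i. L0 i j * norm (p' j - p j)) \<and>
      norm (grad (Acts G i) (\<lambda>x. cost G i (p'(i := x)) \<theta>) (p i) -
            grad (Acts G i) (\<lambda>x. cost G i (p(i := x)) \<theta>) (p i))
        \<le> (\<Sum>j\<in>others G i. L1 i j * norm (p' j - p j))"
    and Z0: "i \<in> Players G \<Longrightarrow> Z0 i \<subseteq> Params G \<and> (AE z in prior G i. z \<in> Z0 i)"
    and kal_nonneg: "i \<in> Players G \<Longrightarrow> 0 \<le> kal0 i \<and> 0 \<le> kal1 i"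
    and al_grad_lipschitz: "i \<in> Players G \<Longrightarrow> f \<in> strategies G (others G i) \<Longrightarrow>
      f' \<in> strategies G (others G i) \<Longrightarrow> x \<in> Types G i \<Longrightarrow> a \<in> Acts G i \<Longrightarrow> z \<in> Z0 i \<Longrightarrow>
      norm (grad (Acts G i) (\<lambda>y. al_risk G i f x y z) a -
            grad (Acts G i) (\<lambda>y. al_risk G i f' x y z) a)
        \<le> kal1 i * (SUP \<xi>\<in>opp_types G i. norm (grad (Acts G i) (\<lambda>y. loss G i f x y \<xi>) a -
                                               grad (Acts G i) (\<lambda>y. loss G i f' x y \<xi>) a))
          + kal0 i * (SUP \<xi>\<in>opp_types G i. \<bar>loss G i f x a \<xi> - loss G i f' x a \<xi>\<bar>)"
    and kep_nonneg: "i \<in> Players G \<Longrightarrow> 0 \<le> kep0 i \<and> 0 \<le> kep1 i"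
    and objective_diff: "i \<in> Players G \<Longrightarrow> \<mu> \<in> posteriors G i \<Longrightarrow> f \<in> strategies G (others G i) \<Longrightarrow>
      x \<in> Types G i \<Longrightarrow> objective G i \<mu> f x differentiable_on Acts G i"
    and ep_grad_lipschitz: "i \<in> Players G \<Longrightarrow> \<mu> \<in> posteriors G i \<Longrightarrow> f \<in> strategies G (others G i) \<Longrightarrow>
      f' \<in> strategies G (others G i) \<Longrightarrow> x \<in> Types G i \<Longrightarrow> a \<in> Acts G i \<Longrightarrow>
      norm (grad (Acts G i) (objective G i \<mu> f x) a - grad (Acts G i) (objective G i \<mu> f' x) a)
        \<le> kep1 i * (SUP z\<in>Z0 i. norm (grad (Acts G i) (\<lambda>y. al_risk G i f x y z) a -
                                       grad (Acts G i) (\<lambda>y. al_risk G i f' x y z) a))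
          + kep0 i * (SUP z\<in>Z0 i. \<bar>al_risk G i f x a z - al_risk G i f' x a z\<bar>)"
    and K: "K i j = (if i = j then 0
      else kep1 i * (kal1 i * L1 i j + kal0 i * L0 i j) + kep0 i * L0 i j)"
    and Gam: "Gam = mat (n_players G) (n_players G) (\<lambda>(i, j). K i j / M i)"
    and spectral: "spectral_radius (map_mat complex_of_real Gam) < 1"
    and Inv: "Inv = the (mat_inverse (1\<^sub>m (n_players G) - Gam))"
begin

text \<open>Bounding a real supremum over \<open>Z0 i\<close> requires a nonempty set; an empty one
  could not have full measure under the prior.\<close>

lemma Z0_nonempty: "i \<in> Players G \<Longrightarrow> Z0 i \<noteq> {}"
proof
  assume i: "i \<in> Players G" and empty: "Z0 i = {}"
  interpret prob_space "prior G i" using game i by (auto simp: bayes_game_def game_beliefs_def)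
  show False using Z0[OF i] empty by simp
qed

lemma loss_lipschitz:
  assumes i: "i \<in> Players G" and f: "f \<in> strategies G (others G i)" "f' \<in> strategies G (others G i)"
    and x: "x \<in> Types G i" and a: "a \<in> Acts G i" and \<xi>: "\<xi> \<in> opp_types G i"
    and \<delta>: "\<And>j y. j \<in> others G i \<Longrightarrow> y \<in> Types G j \<Longrightarrow> norm (f j y - f' j y) \<le> \<delta> j"
  shows "\<bar>loss G i f x a \<xi> - loss G i f' x a \<xi>\<bar> \<le> (\<Sum>j\<in>others G i. L0 i j * \<delta> j)"
    and "norm (grad (Acts G i) (\<lambda>y. loss G i f x y \<xi>) a - grad (Acts G i) (\<lambda>y. loss G i f' x y \<xi>) a)
        \<le> (\<Sum>j\<in>others G i. L1 i j * \<delta> j)"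
proof -
  let ?a = "joint i f' a \<xi>" and ?a' = "joint i f a \<xi>"
  have *: "\<bar>cost G i ?a' (\<xi>(i := x)) - cost G i ?a (\<xi>(i := x))\<bar> \<le> (\<Sum>j\<in>others G i. L0 i j * norm (?a' j - ?a j)) \<and>
      norm (grad (Acts G i) (\<lambda>y. cost G i (?a'(i := y)) (\<xi>(i := x))) (?a i) -
            grad (Acts G i) (\<lambda>y. cost G i (?a(i := y)) (\<xi>(i := x))) (?a i))
        \<le> (\<Sum>j\<in>others G i. L1 i j * norm (?a' j - ?a j))"
    by (rule cost_lipschitz[OF i joint_in_profiles[OF i f(2) a \<xi>] joint_in_profiles[OF i f(1) a \<xi>]
        upd_in_profiles[OF i x \<xi>]]) (simp add: joint_self[OF i])
  have norm: "norm (?a' j - ?a j) \<le> \<delta> j" if "j \<in> others G i" for j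
    using that \<delta>[OF that, of "\<xi> j"] \<xi> by (auto simp: joint_def opp_types_def PiE_iff)
  have "(\<Sum>j\<in>others G i. L0 i j * norm (?a' j - ?a j)) \<le> (\<Sum>j\<in>others G i. L0 i j * \<delta> j)"
    "(\<Sum>j\<in>others G i. L1 i j * norm (?a' j - ?a j)) \<le> (\<Sum>j\<in>others G i. L1 i j * \<delta> j)"
    using norm L_nonneg[OF i] by (intro sum_mono mult_left_mono; blast)+
  with * show "\<bar>loss G i f x a \<xi> - loss G i f' x a \<xi>\<bar> \<le> (\<Sum>j\<in>others G i. L0 i j * \<delta> j)"
    "norm (grad (Acts G i) (\<lambda>y. loss G i f x y \<xi>) a - grad (Acts G i) (\<lambda>y. loss G i f' x y \<xi>) a)
        \<le> (\<Sum>j\<in>others G i. L1 i j * \<delta> j)"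
    by (auto simp: joint_self[OF i] joint_upd[OF i] loss_joint)
qed

text \<open>\<open>K i j\<close> is the coefficient produced by chaining (B2), (B3) and (B4). Its
  last summand \<open>kep0 i * L0 i j\<close> carries no aleatoric factor because a risk measure is
  1-Lipschitz for the supremum norm.\<close>

lemma objective_grad_lipschitz:
  assumes i: "i \<in> Players G" and \<mu>: "\<mu> \<in> posteriors G i"
    and f: "f \<in> strategies G (others G i)" "f' \<in> strategies G (others G i)"
    and x: "x \<in> Types G i" and a: "a \<in> Acts G i"
    and \<delta>: "\<And>j y. j \<in> others G i \<Longrightarrow> y \<in> Types G j \<Longrightarrow> norm (f j y - f' j y) \<le> \<delta> j"
  shows "norm (grad (Acts G i) (objective G i \<mu> f x) a - grad (Acts G i) (objective G i \<mu> f' x) a)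
      \<le> (\<Sum>j\<in>Players G. K i j * \<delta> j)"
proof -
  let ?S0 = "\<Sum>j\<in>others G i. L0 i j * \<delta> j" and ?S1 = "\<Sum>j\<in>others G i. L1 i j * \<delta> j"
  have "norm (grad (Acts G i) (\<lambda>y. al_risk G i f x y z) a - grad (Acts G i) (\<lambda>y. al_risk G i f' x y z) a)
      \<le> kal1 i * ?S1 + kal0 i * ?S0" if z: "z \<in> Z0 i" for z
    using kal_nonneg[OF i]
    by (intro order_trans[OF al_grad_lipschitz[OF i f x a z]] add_mono mult_left_mono
        cSUP_least opp_types_nonempty loss_lipschitz i f x a \<delta>) auto
  moreover have "\<bar>al_risk G i f x a z - al_risk G i f' x a z\<bar> \<le> ?S0" if z: "z \<in> Z0 i" for z
    using Z0[OF i] z by (intro al_risk_diff_le i f x a loss_lipschitz \<delta>) auto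
  ultimately have "norm (grad (Acts G i) (objective G i \<mu> f x) a - grad (Acts G i) (objective G i \<mu> f' x) a)
      \<le> kep1 i * (kal1 i * ?S1 + kal0 i * ?S0) + kep0 i * ?S0"
    using kep_nonneg[OF i]
    by (intro order_trans[OF ep_grad_lipschitz[OF i \<mu> f x a]] add_mono mult_left_mono
        cSUP_least Z0_nonempty i) auto
  also have "\<dots> = (\<Sum>j\<in>others G i. K i j * \<delta> j)"
    unfolding sum_distrib_left sum.distrib[symmetric]
    by (intro sum.cong refl) (auto simp: K algebra_simps)
  also have "\<dots> = (\<Sum>j\<in>Players G. K i j * \<delta> j)"
    by (intro sum.mono_neutral_left) (auto simp: K)
  finally show ?thesis .
qed

lemma best_response_distance:
  assumes i: "i \<in> Players G" and \<mu>': "\<mu>' \<in> posteriors G i"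
    and f: "f \<in> strategies G (Players G)" "f' \<in> strategies G (Players G)" and x: "x \<in> Types G i"
    and min: "is_arg_min (objective G i \<mu> f x) (\<lambda>a. a \<in> Acts G i) (f i x)"
    and min': "is_arg_min (objective G i \<mu>' f' x) (\<lambda>a. a \<in> Acts G i) (f' i x)"
    and diff: "objective G i \<mu> f x differentiable (at (f i x) within Acts G i)"
    and \<delta>: "\<And>j y. j \<in> Players G \<Longrightarrow> y \<in> Types G j \<Longrightarrow> norm (f j y - f' j y) \<le> \<delta> j"
  shows "norm (f i x - f' i x) \<le> (\<Sum>j<n_players G. Gam $$ (i, j) * \<delta> j)
    + 1 / M i * norm (grad (Acts G i) (objective G i \<mu>' f x) (f i x) -
                      grad (Acts G i) (objective G i \<mu> f x) (f i x))"
    (is "_ \<le> _ + 1 / M i * ?d")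
proof -
  have a: "f i x \<in> Acts G i" by (rule strategiesD[OF f(1) i x])
  note fo = strategies_others[OF f(1), of i] strategies_others[OF f(2), of i]
  let ?grad = "\<lambda>\<mu> g. grad (Acts G i) (objective G i \<mu> g x) (f i x)"
  \<comment> \<open>Here \<open>V\<close> is the objective under \<mu>' against the opponents in
    \<open>f'\<close> and \<open>U\<close> the one under \<mu> against those in \<open>f\<close>,
    both differentiated at \<open>f i x\<close>.\<close>
  have "M i * norm (f i x - f' i x) \<le> norm (?grad \<mu>' f' - ?grad \<mu> f)"
    using objective_diff[OF i \<mu>' fo(2) x] a
    by (intro minimizer_distance_le_grad Acts i objective_convex fo x posteriors_belief[OF i \<mu>'] min min' diff)
      (auto simp: differentiable_on_def)
  \<comment> \<open>The inserted gradient, belief \<mu>' against the opponents in \<open>f\<close>,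
    separates the change of opponents from the change of belief.\<close>
  also have "\<dots> \<le> norm (?grad \<mu>' f - ?grad \<mu>' f') + ?d"
    using norm_triangle_ineq[of "?grad \<mu>' f' - ?grad \<mu>' f" "?grad \<mu>' f - ?grad \<mu> f"]
    by (simp add: norm_minus_commute)
  also have "\<dots> \<le> (\<Sum>j\<in>Players G. K i j * \<delta> j) + ?d"
    using \<delta> by (intro add_right_mono objective_grad_lipschitz i \<mu>' fo x a) auto
  finally have "norm (f i x - f' i x) \<le> ((\<Sum>j\<in>Players G. K i j * \<delta> j) + ?d) / M i"
    using M_pos[OF i] by (simp add: field_simps)
  also have "\<dots> = (\<Sum>j<n_players G. Gam $$ (i, j) * \<delta> j) + 1 / M i * ?d"
    using i by (auto simp: Gam add_divide_distrib sum_divide_distrib intro!: sum.cong)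
  finally show ?thesis .
qed

lemma Inv_nonneg: "i \<in> Players G \<Longrightarrow> j \<in> Players G \<Longrightarrow> 0 \<le> Inv $$ (i, j)"
  and Inv_diag: "i \<in> Players G \<Longrightarrow> 1 \<le> Inv $$ (i, i)"
  and Inv_bound: "(\<And>i. i \<in> Players G \<Longrightarrow> u i \<le> (\<Sum>j<n_players G. Gam $$ (i, j) * u j) + d i) \<Longrightarrow>
    i \<in> Players G \<Longrightarrow> u i \<le> (\<Sum>j\<in>Players G. Inv $$ (i, j) * d j)"
proof -
  have Gam_carrier: "Gam \<in> carrier_mat (n_players G) (n_players G)" by (simp add: Gam)
  have Gam_nonneg: "0 \<le> Gam $$ (i, j)" if "i < n_players G" "j < n_players G" for i j
    using that L_nonneg[of i j] kal_nonneg[of i] kep_nonneg[of i] M_pos[of i]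
    by (auto simp: Gam K)
  note R = nonneg_resolvent[OF Gam_carrier Gam_nonneg spectral Inv]
  show "i \<in> Players G \<Longrightarrow> j \<in> Players G \<Longrightarrow> 0 \<le> Inv $$ (i, j)" using R(1) by simp
  show "i \<in> Players G \<Longrightarrow> 1 \<le> Inv $$ (i, i)" using R(2) by simp
  show "(\<And>i. i \<in> Players G \<Longrightarrow> u i \<le> (\<Sum>j<n_players G. Gam $$ (i, j) * u j) + d i) \<Longrightarrow>
    i \<in> Players G \<Longrightarrow> u i \<le> (\<Sum>j\<in>Players G. Inv $$ (i, j) * d j)"
    using R(3)[of u d i] by simp
qed

lemma strategy_diff_bounded:
  assumes "j \<in> Players G" "f \<in> strategies G (Players G)" "f' \<in> strategies G (Players G)"
  shows "bdd_above ((\<lambda>y. norm (f j y - f' j y)) ` Types G j)"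
proof -
  obtain b where b: "\<And>a. a \<in> Acts G j \<Longrightarrow> norm a \<le> b"
    using compact_imp_bounded[OF Acts(2)[OF assms(1)]] unfolding bounded_iff by blast
  show ?thesis
  proof (rule bdd_aboveI2)
    fix y assume y: "y \<in> Types G j"
    show "norm (f j y - f' j y) \<le> b + b"
      using b[OF strategiesD[OF assms(2,1) y]] b[OF strategiesD[OF assms(3,1) y]]
      by (intro order_trans[OF norm_triangle_ineq4]) simp
  qed
qed

text \<open>\<open>d\<close> is any real bound on the belief terms, and the player obtained is one
  attaining the maximum in \<open>strategy_norm\<close>. In this form the estimate serves both the
  extended-real bound of (i) and the rate of (ii). Membership in \<open>posteriors\<close> is asked
  of \<mu>' alone, which leaves \<mu> free to be the Dirac belief.\<close>

lemma equilibrium_distance: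
  assumes \<mu>': "\<And>i. i \<in> Players G \<Longrightarrow> \<mu>' i \<in> posteriors G i"
    and f: "BNE_RABL G \<mu> f" and f': "BNE_RABL G \<mu>' f'"
    and diff: "\<And>i x. i \<in> Players G \<Longrightarrow> x \<in> Types G i \<Longrightarrow>
      objective G i (\<mu> i) f x differentiable (at (f i x) within Acts G i)"
    and d: "\<And>i x. i \<in> Players G \<Longrightarrow> x \<in> Types G i \<Longrightarrow>
      1 / M i * norm (grad (Acts G i) (objective G i (\<mu>' i) f x) (f i x) -
                      grad (Acts G i) (objective G i (\<mu> i) f x) (f i x)) \<le> d i"
  obtains i where "i \<in> Players G"
    "strategy_norm G (\<lambda>j x. f j x - f' j x) \<le> (\<Sum>j\<in>Players G. Inv $$ (i, j) * d j)"
proof -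
  have fs: "f \<in> strategies G (Players G)" "f' \<in> strategies G (Players G)"
    using f f' by (auto simp: BNE_RABL_def)
  define \<delta> where "\<delta> j = (SUP y\<in>Types G j. norm (f j y - f' j y))" for j
  have \<delta>: "norm (f j y - f' j y) \<le> \<delta> j" if "j \<in> Players G" "y \<in> Types G j" for j y
    unfolding \<delta>_def using that by (intro cSUP_upper strategy_diff_bounded fs)
  have "\<delta> i \<le> (\<Sum>j\<in>Players G. Inv $$ (i, j) * d j)" if "i \<in> Players G" for i
  proof (rule Inv_bound[OF _ that])
    fix i assume i: "i \<in> Players G"
    show "\<delta> i \<le> (\<Sum>j<n_players G. Gam $$ (i, j) * \<delta> j) + d i"
      unfolding \<delta>_def[of i]
    proof (rule cSUP_least[OF Types(1)[OF i]])
      fix x assume x: "x \<in> Types G i"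
      have "norm (f i x - f' i x) \<le> (\<Sum>j<n_players G. Gam $$ (i, j) * \<delta> j)
        + 1 / M i * norm (grad (Acts G i) (objective G i (\<mu>' i) f x) (f i x) -
                          grad (Acts G i) (objective G i (\<mu> i) f x) (f i x))"
        using f f' i x by (intro best_response_distance \<mu>' fs diff \<delta>) (auto simp: BNE_RABL_def)
      also have "\<dots> \<le> (\<Sum>j<n_players G. Gam $$ (i, j) * \<delta> j) + d i"
        by (intro add_left_mono d i x)
      finally show "norm (f i x - f' i x) \<le> (\<Sum>j<n_players G. Gam $$ (i, j) * \<delta> j) + d i" .
    qed
  qed
  moreover have "strategy_norm G (\<lambda>j x. f j x - f' j x) \<in> \<delta> ` Players G"
    unfolding strategy_norm_def \<delta>_def using players by (intro Max_in) auto
  ultimately show ?thesis using that by auto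
qed

text \<open>Extended reals keep the supremum over types meaningful when the gradient differences are
  unbounded. If all suprema are finite, \<open>equilibrium_distance\<close> applies to their real
  values.\<close>

lemma equilibrium_stability:
  assumes \<mu>: "\<And>i. i \<in> Players G \<Longrightarrow> \<mu> i \<in> posteriors G i \<and> \<mu>' i \<in> posteriors G i"
    and f: "BNE_RABL G \<mu> f" and f': "BNE_RABL G \<mu>' f'"
  shows "ereal (strategy_norm G (\<lambda>j x. f j x - f' j x)) \<le>
        (MAX i\<in>Players G. \<Sum>j\<in>Players G. ereal (Inv $$ (i, j)) *
           (ereal (1 / M j) *
            (SUP x\<in>Types G j. ereal (norm (grad (Acts G j) (objective G j (\<mu>' j) f x) (f j x) -
                                           grad (Acts G j) (objective G j (\<mu> j) f x) (f j x))))))"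
proof -
  define d where "d j x = norm (grad (Acts G j) (objective G j (\<mu>' j) f x) (f j x) -
      grad (Acts G j) (objective G j (\<mu> j) f x) (f j x))" for j x
  define s where "s j = (SUP x\<in>Types G j. ereal (d j x))" for j
  let ?S = "\<lambda>i. \<Sum>j\<in>Players G. ereal (Inv $$ (i, j)) * (ereal (1 / M j) * s j)"
  have upper: "ereal (d j x) \<le> s j" if "x \<in> Types G j" for j x
    unfolding s_def by (rule SUP_upper[OF that])
  have s_nonneg: "0 \<le> s j" if j: "j \<in> Players G" for j
  proof -
    obtain x where x: "x \<in> Types G j" using Types(1)[OF j] by blast
    have "0 \<le> ereal (d j x)" by (simp add: d_def)
    then show ?thesis using upper[OF x] by (rule order_trans)
  qed
  have fs: "f \<in> strategies G (Players G)" using f by (simp add: BNE_RABL_def)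
  have "\<exists>i\<in>Players G. ereal (strategy_norm G (\<lambda>j x. f j x - f' j x)) \<le> ?S i"
  proof (cases "\<exists>i\<in>Players G. s i = \<infinity>")
    case True
    then obtain i where i: "i \<in> Players G" and inf: "s i = \<infinity>" by blast
    \<comment> \<open>In \<open>ereal\<close> a zero coefficient would cancel the infinite supremum.
      Row \<open>i\<close> avoids this, since its diagonal entry is at least 1.\<close>
    have "\<infinity> = ereal (Inv $$ (i, i)) * (ereal (1 / M i) * s i)"
      using Inv_diag[OF i] M_pos[OF i] inf by simp
    also have "\<dots> \<le> ?S i"
      using i Inv_nonneg M_pos s_nonneg
        sum_mono2[of "Players G" "{i}" "\<lambda>j. ereal (Inv $$ (i, j)) * (ereal (1 / M j) * s j)"]
      by (auto simp: less_imp_le)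
    finally show ?thesis using i by (intro bexI[of _ i]) simp_all
  next
    case False
    define d' where "d' j = real_of_ereal (s j)" for j
    have s: "s j = ereal (d' j)" if "j \<in> Players G" for j
      using that False s_nonneg[OF that] by (cases "s j") (auto simp: d'_def)
    obtain i where i: "i \<in> Players G"
      and le: "strategy_norm G (\<lambda>j x. f j x - f' j x) \<le> (\<Sum>j\<in>Players G. Inv $$ (i, j) * (1 / M j * d' j))"
    proof (rule equilibrium_distance[OF _ f f'])
      fix i x assume i: "i \<in> Players G" and x: "x \<in> Types G i"
      show "objective G i (\<mu> i) f x differentiable (at (f i x) within Acts G i)"
        using objective_diff[OF i _ strategies_others[OF fs] x] \<mu>[OF i] strategiesD[OF fs i x]
        by (auto simp: differentiable_on_def)
      have "d i x \<le> d' i" using upper[OF x] s[OF i] by simp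
      then show "1 / M i * norm (grad (Acts G i) (objective G i (\<mu>' i) f x) (f i x) -
          grad (Acts G i) (objective G i (\<mu> i) f x) (f i x)) \<le> 1 / M i * d' i"
        using M_pos[OF i] by (intro mult_left_mono) (auto simp: d_def)
    qed (use \<mu> in auto)
    have "?S i = (\<Sum>j\<in>Players G. ereal (Inv $$ (i, j) * (1 / M j * d' j)))"
      by (intro sum.cong refl) (simp add: s)
    then show ?thesis using i le by (intro bexI[of _ i]) (simp_all add: sum_ereal)
  qed
  then obtain i where i: "i \<in> Players G" and "ereal (strategy_norm G (\<lambda>j x. f j x - f' j x)) \<le> ?S i" by blast
  then have "ereal (strategy_norm G (\<lambda>j x. f j x - f' j x)) \<le> (MAX i\<in>Players G. ?S i)"
    by (intro order_trans[OF _ Max_ge]) auto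
  then show ?thesis by (simp only: s_def d_def)
qed

end

section \<open>Gradient regular risk measures\<close>

lemma prob_at_least_Ball:
  assumes P: "prob_space P" and I: "finite I" "I \<noteq> {}"
    and E: "\<And>i. i \<in> I \<Longrightarrow> prob_at_least P (1 - \<epsilon> / card I) (E i)"
  shows "prob_at_least P (1 - \<epsilon>) (\<lambda>w. \<forall>i\<in>I. E i w)"
proof -
  interpret prob_space P by fact
  obtain S where S: "\<And>i. i \<in> I \<Longrightarrow> S i \<in> sets P" "\<And>i w. i \<in> I \<Longrightarrow> w \<in> S i \<Longrightarrow> E i w"
    "\<And>i. i \<in> I \<Longrightarrow> 1 - \<epsilon> / card I \<le> prob (S i)"
    using E unfolding prob_at_least_def by metis
  \<comment> \<open>Union bound for the complements of the measurable inner sets; the events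
    \<open>E i\<close> themselves may fail to be measurable.\<close>
  have "prob (space P - (\<Inter>i\<in>I. S i)) = prob (\<Union>i\<in>I. space P - S i)"
    using I by (intro arg_cong[where f = prob]) auto
  also have "\<dots> \<le> (\<Sum>i\<in>I. prob (space P - S i))"
    using S(1) I by (intro finite_measure_subadditive_finite) auto
  also have "\<dots> \<le> (\<Sum>i\<in>I. \<epsilon> / card I)"
    using S(1,3) by (intro sum_mono) (simp add: prob_compl, fastforce)
  also have "\<dots> = \<epsilon>" using I by simp
  finally have "1 - \<epsilon> \<le> prob (\<Inter>i\<in>I. S i)"
    using S(1) I by (subst (asm) prob_compl) (auto intro!: sets.finite_INT)
  moreover have "(\<Inter>i\<in>I. S i) \<in> sets P" using S(1) I by (intro sets.finite_INT) auto
  ultimately show ?thesis using S(2) unfolding prob_at_least_def by (intro bexI[of _ "\<Inter>i\<in>I. S i"]) auto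
qed

text \<open>A measurable null set covering the exceptions is removed from the inner set at no cost.
  Membership in \<open>space P\<close> is recorded because posteriors are considered only for
  histories in that space.\<close>

lemma prob_at_least_AE:
  assumes P: "prob_space P" and E: "prob_at_least P q E" and ae: "AE w in P. F w"
  shows "prob_at_least P q (\<lambda>w. w \<in> space P \<and> E w \<and> F w)"
proof -
  interpret prob_space P by fact
  obtain S where S: "S \<in> sets P" "\<And>w. w \<in> S \<Longrightarrow> E w" "q \<le> prob S"
    using E unfolding prob_at_least_def by blast
  obtain N where N: "{w \<in> space P. \<not> F w} \<subseteq> N" "N \<in> sets P" "prob N = 0"
    using ae by (rule AE_E) (auto simp: emeasure_eq_measure)
  have "prob (S - N) = prob S"
    using N S(1) by (intro measure_Diff_null_set) (auto simp: null_sets_def emeasure_eq_measure)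
  moreover have "F w" if "w \<in> S - N" for w
    using that N(1) sets.sets_into_space[OF S(1)] by blast
  ultimately show ?thesis
    using S N(2) sets.sets_into_space[OF S(1)] unfolding prob_at_least_def
    by (intro bexI[of _ "S - N"]) auto
qed

lemma prob_at_least_mono:
  "prob_at_least P q E \<Longrightarrow> (\<And>w. E w \<Longrightarrow> F w) \<Longrightarrow> prob_at_least P q F"
  unfolding prob_at_least_def by blast

text \<open>A pointwise substitute for Jensen's inequality: y^r is s^(r/2) times the power r/2 \<le>
  1 of y^2/s, and enlarging the base to 1 + y^2/s \<ge> 1 permits exponent 1. If the second moment
  is at most \<open>s\<close>, integration gives \<open>2 * s powr (r / 2)\<close>.\<close>

lemma powr_half_le:
  fixes y s r :: real
  assumes "0 \<le> y" "0 < s" "0 < r" "r \<le> 2"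
  shows "y powr r \<le> s powr (r / 2) * (1 + y\<^sup>2 / s)"
proof (cases "y = 0")
  case False
  with assms have y: "0 < y" by simp
  have "y powr r = (y\<^sup>2) powr (r / 2)"
    using powr_powr[of y 2 "r / 2"] y by simp
  also have "\<dots> = (s * (y\<^sup>2 / s)) powr (r / 2)" using assms by simp
  also have "\<dots> = s powr (r / 2) * (y\<^sup>2 / s) powr (r / 2)"
    by (rule powr_mult)
  also have "(y\<^sup>2 / s) powr (r / 2) \<le> (1 + y\<^sup>2 / s) powr (r / 2)"
    using assms by (intro powr_mono2) auto
  also have "(1 + y\<^sup>2 / s) powr (r / 2) \<le> (1 + y\<^sup>2 / s) powr 1"
    using assms by (intro powr_mono) auto
  also have "\<dots> = 1 + y\<^sup>2 / s" using assms by (intro powr_one) auto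
  finally show ?thesis by (simp add: mult_left_mono)
qed (use assms in simp)

text \<open>Holds the deterministic conditions (C2) to (C4). The probabilistic condition (C1) stays
  outside, so that the estimates can be made for one history at a time.\<close>

locale regular_game = learning_game G M kal0 kal1 kep0 kep1 L0 L1 K Z0 Gam Inv
  for G :: "('a::euclidean_space, 'b::euclidean_space, 'z::euclidean_space) bayes_game" and M
    and kal0 kal1 kep0 kep1 L0 L1 K Z0 Gam Inv +
  fixes Wal :: "(nat \<Rightarrow> 'b) measure \<Rightarrow> 'a set \<Rightarrow> ('a \<Rightarrow> (nat \<Rightarrow> 'b) \<Rightarrow> real) \<Rightarrow> 'a \<Rightarrow> (nat \<Rightarrow> 'b) \<Rightarrow> real"
    and Wep :: "'z measure \<Rightarrow> 'a set \<Rightarrow> ('a \<Rightarrow> 'z \<Rightarrow> real) \<Rightarrow> 'a \<Rightarrow> 'z \<Rightarrow> real"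
    and wal wep lam Leta r e gbar :: "nat \<Rightarrow> real"
  assumes al_regular: "gradient_regular (rho_al G) Wal"
    and ep_regular: "gradient_regular (rho_ep G) Wep"
    and Wal_range: "\<forall>i\<in>Players G. \<forall>f\<in>strategies G (others G i). \<forall>x\<in>Types G i. \<forall>a\<in>Acts G i. \<forall>z\<in>Params G.
      \<forall>\<xi>\<in>opp_types G i. Wal (cond G i x z) (Acts G i) (loss G i f x) a \<xi> \<in> {0..wal i}"
    and Wep_range: "\<forall>i\<in>Players G. \<forall>f\<in>strategies G (others G i). \<forall>x\<in>Types G i. \<forall>a\<in>Acts G i.
      \<forall>\<mu>\<in>posteriors G i. \<forall>z\<in>Params G. Wep \<mu> (Acts G i) (al_risk G i f x) a z \<in> {0..wep i}"
    and lam_nonneg: "\<forall>i\<in>Players G. 0 \<le> lam i"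
    and Wal_lipschitz: "\<forall>i\<in>Players G. \<forall>f\<in>strategies G (others G i). \<forall>x\<in>Types G i. \<forall>a\<in>Acts G i. \<forall>z\<in>Params G.
      (LINT \<xi>|cond G i x (true_param G).
        \<bar>Wal (cond G i x z) (Acts G i) (loss G i f x) a \<xi> -
         Wal (cond G i x (true_param G)) (Acts G i) (loss G i f x) a \<xi>\<bar>)
        \<le> lam i * dTV (cond G i x z) (cond G i x (true_param G))"
    and exponents: "\<forall>i\<in>Players G. 0 < Leta i \<and> 0 < r i \<and> r i \<le> 2 \<and> 0 < e i"
    and cond_holder: "\<forall>i\<in>Players G. \<forall>x\<in>Types G i. \<forall>z\<in>Params G \<inter> ball (true_param G) (e i).
      dTV (cond G i x z) (cond G i x (true_param G)) \<le> Leta i * norm (z - true_param G) powr r i"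
    and cost_grad_bound: "\<forall>i\<in>Players G. \<forall>a\<in>action_profiles G. \<forall>\<theta>\<in>type_profiles G.
      norm (grad (Acts G i) (\<lambda>x. cost G i (a(i := x)) \<theta>) (a i)) \<le> gbar i"
begin

context
  fixes i f x a
  assumes i: "i \<in> Players G" and f: "f \<in> strategies G (others G i)" and x: "x \<in> Types G i" and a: "a \<in> Acts G i"
begin

abbreviation (input) "gloss \<equiv> \<lambda>\<xi>. grad (Acts G i) (\<lambda>y. loss G i f x y \<xi>) a"
abbreviation (input) "gal \<equiv> \<lambda>z. grad (Acts G i) (\<lambda>y. al_risk G i f x y z) a"
abbreviation (input) "wt \<equiv> \<lambda>z. Wal (cond G i x z) (Acts G i) (loss G i f x) a"

lemma norm_grad_loss: "b \<in> Acts G i \<Longrightarrow> \<xi> \<in> opp_types G i \<Longrightarrow>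
    norm (grad (Acts G i) (\<lambda>y. loss G i f x y \<xi>) b) \<le> gbar i"
  using cost_grad_bound[rule_format, OF i joint_in_profiles[OF i f, of b \<xi>] upd_in_profiles[OF i x, of \<xi>]]
  by (simp add: joint_self[OF i] joint_upd[OF i] loss_joint)

lemma gbar_nonneg: "0 \<le> gbar i"
proof -
  obtain \<xi> where "\<xi> \<in> opp_types G i" using opp_types_nonempty by blast
  from norm_grad_loss[OF a this] show ?thesis using norm_ge_zero by (rule order_trans[rotated])
qed

lemma wt_range: "z \<in> Params G \<Longrightarrow> \<xi> \<in> opp_types G i \<Longrightarrow> 0 \<le> wt z \<xi> \<and> wt z \<xi> \<le> wal i"
  using Wal_range i f x a by simp

lemma wal_nonneg: "0 \<le> wal i"
proof -
  obtain \<xi> where "\<xi> \<in> opp_types G i" using opp_types_nonempty by blast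
  from wt_range[OF Params(2) this] show ?thesis by linarith
qed

lemma bounded_differentiable_loss_loss:
  assumes z: "z \<in> Params G"
  shows "bounded_differentiable_loss (cond G i x z) (Acts G i) (loss G i f x)"
proof -
  obtain b where b: "\<And>a \<xi>. a \<in> Acts G i \<Longrightarrow> \<xi> \<in> opp_types G i \<Longrightarrow> \<bar>loss G i f x a \<xi>\<bar> \<le> b"
    using loss_bounded[OF i f x] by blast
  show ?thesis
    unfolding bounded_differentiable_loss_def
  proof (intro conjI ballI exI)
    fix b' \<xi> assume "b' \<in> Acts G i" "\<xi> \<in> space (cond G i x z)"
    then have "b' \<in> Acts G i" "\<xi> \<in> opp_types G i" by (simp_all add: cond_prob[OF i x z])
    from b[OF this] norm_grad_loss[OF this]
    show "\<bar>loss G i f x b' \<xi>\<bar> \<le> max b (gbar i)"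
      "norm (grad (Acts G i) (\<lambda>y. loss G i f x y \<xi>) b') \<le> max b (gbar i)" by auto
  next
    fix \<xi> assume "\<xi> \<in> space (cond G i x z)"
    then show "(\<lambda>y. loss G i f x y \<xi>) differentiable_on Acts G i"
      by (intro loss_diff[OF i f x a]) (simp add: cond_prob[OF i x z])
  qed (rule loss_measurable_cond[OF i f x z])
qed

lemma al_risk_gradient:
  assumes z: "z \<in> Params G"
  shows "wt z \<in> borel_measurable (types_space G (others G i))"
    "(LINT \<xi>|cond G i x z. wt z \<xi>) = 1"
    "(\<lambda>y. al_risk G i f x y z) differentiable (at a within Acts G i)"
    "gal z = (LINT \<xi>|cond G i x z. wt z \<xi> *\<^sub>R gloss \<xi>)"
proof -
  have *: "wt z \<in> borel_measurable (cond G i x z) \<and> (LINT \<xi>|cond G i x z. wt z \<xi>) = 1 \<and>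
      (\<lambda>y. risk (rho_al G) (cond G i x z) (loss G i f x y)) differentiable (at a within Acts G i) \<and>
      grad (Acts G i) (\<lambda>y. risk (rho_al G) (cond G i x z) (loss G i f x y)) a =
        (LINT \<xi>|cond G i x z. wt z \<xi> *\<^sub>R gloss \<xi>)"
    using al_regular[unfolded gradient_regular_def, rule_format, OF cond_prob(1)[OF i x z]
      Acts(2)[OF i] Acts(3)[OF i] a bounded_differentiable_loss_loss[OF z]] by simp
  show "wt z \<in> borel_measurable (types_space G (others G i))"
    by (subst measurable_cong_sets[OF cond_prob(2)[OF i x z, symmetric] refl]) (use * in simp)
  show "(LINT \<xi>|cond G i x z. wt z \<xi>) = 1" using * by simp
  show "(\<lambda>y. al_risk G i f x y z) differentiable (at a within Acts G i)"
    "gal z = (LINT \<xi>|cond G i x z. wt z \<xi> *\<^sub>R gloss \<xi>)" using * unfolding al_risk_def by blast+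
qed

lemma gloss_measurable: "gloss \<in> borel_measurable (types_space G (others G i))"
proof (rule grad_measurable[OF Acts(3)[OF i] a loss_measurable[OF i f x]])
  show "(\<lambda>y. loss G i f x y \<xi>) differentiable (at a within Acts G i)"
    if "\<xi> \<in> space (types_space G (others G i))" for \<xi>
    using loss_diff[OF i f x a, of \<xi>] that a by (simp add: space_types differentiable_on_def)
qed

lemma measurable_cond: "z \<in> Params G \<Longrightarrow> g \<in> borel_measurable (types_space G (others G i)) \<Longrightarrow>
    g \<in> borel_measurable (cond G i x z)"
  by (subst measurable_cong_sets[OF cond_prob(2)[OF i x] refl]) auto

text \<open>Two parameters occur because the comparison with the true one integrates the weight
  belonging to \<open>z\<close> against the conditional distribution belonging to
  \<open>z'\<close>.\<close>

lemma integrable_wt: "z \<in> Params G \<Longrightarrow> z' \<in> Params G \<Longrightarrow> integrable (cond G i x z') (wt z)"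
  and integrable_wt_gloss: "z \<in> Params G \<Longrightarrow> z' \<in> Params G \<Longrightarrow>
    integrable (cond G i x z') (\<lambda>\<xi>. wt z \<xi> *\<^sub>R gloss \<xi>)"
proof -
  assume z: "z \<in> Params G" and z': "z' \<in> Params G"
  interpret prob_space "cond G i x z'" by (rule cond_prob[OF i x z'])
  show "integrable (cond G i x z') (wt z)"
    using wt_range[OF z]
    by (intro integrable_const_bound[of _ "wal i"] measurable_cond z' al_risk_gradient z AE_I2)
      (simp add: cond_prob[OF i x z'])
  show "integrable (cond G i x z') (\<lambda>\<xi>. wt z \<xi> *\<^sub>R gloss \<xi>)"
  proof (rule integrable_const_bound[of _ "wal i * gbar i"])
    show "AE \<xi> in cond G i x z'. norm (wt z \<xi> *\<^sub>R gloss \<xi>) \<le> wal i * gbar i"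
      using wt_range[OF z] norm_grad_loss[OF a]
      by (intro AE_I2) (auto simp: cond_prob[OF i x z'] intro!: mult_mono wal_nonneg)
    show "(\<lambda>\<xi>. wt z \<xi> *\<^sub>R gloss \<xi>) \<in> borel_measurable (cond G i x z')"
      by (intro measurable_cond borel_measurable_scaleR al_risk_gradient gloss_measurable z z')
  qed
qed

text \<open>The weights are nonnegative with mean one, so the gradient of the risk is an average of
  gradients of the loss and obeys the same bound, without the factor \<open>wal i\<close>.\<close>

lemma norm_gal:
  assumes z: "z \<in> Params G" shows "norm (gal z) \<le> gbar i"
proof -
  have "norm (gal z) \<le> (LINT \<xi>|cond G i x z. norm (wt z \<xi> *\<^sub>R gloss \<xi>))"
    unfolding al_risk_gradient(4)[OF z] by (rule integral_norm_bound)
  also have "\<dots> \<le> (LINT \<xi>|cond G i x z. wt z \<xi> * gbar i)"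
    using wt_range[OF z] norm_grad_loss[OF a]
    by (intro integral_mono integrable_norm integrable_wt_gloss integrable_mult_left integrable_wt z)
      (auto simp: cond_prob[OF i x z] intro!: mult_left_mono)
  also have "\<dots> = gbar i" using al_risk_gradient(2)[OF z] by simp
  finally show ?thesis .
qed

text \<open>Inserting the integral of the weighted gradient for \<open>z\<close> under the true
  conditional distribution splits the difference: changing the measure costs
  \<open>2 * wal i * gbar i\<close>, changing the weight costs \<open>gbar i * lam i\<close>, both
  times the total variation distance.\<close>

lemma gal_dTV:
  assumes z: "z \<in> Params G"
  shows "norm (gal z - gal (true_param G))
    \<le> (2 * wal i * gbar i + gbar i * lam i) * dTV (cond G i x z) (cond G i x (true_param G))"
proof -
  let ?t = "true_param G" and ?d = "dTV (cond G i x z) (cond G i x (true_param G))"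
  let ?P = "cond G i x z" and ?Q = "cond G i x ?t"
  note t = Params(2)
  have split: "gal z - gal ?t = ((LINT \<xi>|?P. wt z \<xi> *\<^sub>R gloss \<xi>) - (LINT \<xi>|?Q. wt z \<xi> *\<^sub>R gloss \<xi>))
      + (LINT \<xi>|?Q. (wt z \<xi> - wt ?t \<xi>) *\<^sub>R gloss \<xi>)"
    using integrable_wt_gloss z t
    by (simp add: al_risk_gradient(4) scaleR_diff_left)
  have sets: "sets ?Q = sets ?P"
    by (rule trans[OF cond_prob(2)[OF i x t] cond_prob(2)[OF i x z, symmetric]])
  have bound: "norm (wt z \<xi> *\<^sub>R gloss \<xi>) \<le> wal i * gbar i" if "\<xi> \<in> space ?P" for \<xi>
    using that wt_range[OF z] norm_grad_loss[OF a]
    by (auto simp: cond_prob[OF i x z] intro!: mult_mono wal_nonneg)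
  have first: "norm ((LINT \<xi>|?P. wt z \<xi> *\<^sub>R gloss \<xi>) - (LINT \<xi>|?Q. wt z \<xi> *\<^sub>R gloss \<xi>))
      \<le> 2 * (wal i * gbar i) * ?d"
    by (rule norm_integral_diff_le_dTV[OF cond_prob(1)[OF i x z] cond_prob(1)[OF i x t] sets
        borel_measurable_integrable[OF integrable_wt_gloss[OF z z]] bound])
  have "norm (LINT \<xi>|?Q. (wt z \<xi> - wt ?t \<xi>) *\<^sub>R gloss \<xi>)
      \<le> (LINT \<xi>|?Q. norm ((wt z \<xi> - wt ?t \<xi>) *\<^sub>R gloss \<xi>))" by (rule integral_norm_bound)
  also have "\<dots> \<le> (LINT \<xi>|?Q. \<bar>wt z \<xi> - wt ?t \<xi>\<bar> * gbar i)"
  proof (rule integral_mono)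
    show "integrable ?Q (\<lambda>\<xi>. norm ((wt z \<xi> - wt ?t \<xi>) *\<^sub>R gloss \<xi>))"
      unfolding scaleR_diff_left
      by (intro integrable_norm Bochner_Integration.integrable_diff integrable_wt_gloss z t)
    show "integrable ?Q (\<lambda>\<xi>. \<bar>wt z \<xi> - wt ?t \<xi>\<bar> * gbar i)"
      by (intro integrable_mult_left integrable_abs Bochner_Integration.integrable_diff integrable_wt z t)
    show "norm ((wt z \<xi> - wt ?t \<xi>) *\<^sub>R gloss \<xi>) \<le> \<bar>wt z \<xi> - wt ?t \<xi>\<bar> * gbar i" if "\<xi> \<in> space ?Q" for \<xi>
      using norm_grad_loss[OF a, of \<xi>] that by (simp add: cond_prob[OF i x t] mult_left_mono)
  qed
  also have "\<dots> = (LINT \<xi>|?Q. \<bar>wt z \<xi> - wt ?t \<xi>\<bar>) * gbar i" by simp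
  also have "\<dots> \<le> (lam i * ?d) * gbar i"
    using Wal_lipschitz i f x a z gbar_nonneg by (intro mult_right_mono) auto
  finally have second: "norm (LINT \<xi>|?Q. (wt z \<xi> - wt ?t \<xi>) *\<^sub>R gloss \<xi>) \<le> (lam i * ?d) * gbar i" .
  have "norm (gal z - gal ?t) \<le> 2 * (wal i * gbar i) * ?d + (lam i * ?d) * gbar i"
    unfolding split by (rule norm_triangle_le[OF add_mono[OF first second]])
  then show ?thesis by (simp add: algebra_simps)
qed

end

text \<open>Gradient regularity used a second time, now in the parameter: \<open>norm_gal\<close>
  and \<open>al_risk_bounded\<close> make the inner risk a bounded differentiable loss.\<close>

lemma objective_gradient:
  assumes i: "i \<in> Players G" and f: "f \<in> strategies G (others G i)" and x: "x \<in> Types G i" and a: "a \<in> Acts G i"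
    and \<mu>: "\<mu> \<in> posteriors G i"
  defines "W \<equiv> Wep \<mu> (Acts G i) (al_risk G i f x) a" and "g \<equiv> \<lambda>z. grad (Acts G i) (\<lambda>y. al_risk G i f x y z) a"
  shows "W \<in> borel_measurable \<mu>" "(LINT z|\<mu>. W z) = 1"
    "grad (Acts G i) (objective G i \<mu> f x) a = (LINT z|\<mu>. W z *\<^sub>R g z)"
    "g \<in> borel_measurable \<mu>"
proof -
  note P = posteriors_belief[OF i \<mu>]
  have sp: "space \<mu> = Params G" using sets_eq_imp_space_eq[OF P(2)] by (simp add: space_restrict_space)
  obtain b where b: "\<And>a z. a \<in> Acts G i \<Longrightarrow> z \<in> Params G \<Longrightarrow> \<bar>al_risk G i f x a z\<bar> \<le> b"
    using al_risk_bounded[OF i f x] by blast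
  have diff: "(\<lambda>y. al_risk G i f x y z) differentiable (at a within Acts G i)"
    if "z \<in> space \<mu>" "a \<in> Acts G i" for z a
    using al_risk_gradient(3)[OF i f x that(2)] that(1) by (simp add: sp)
  have meas: "al_risk G i f x a \<in> borel_measurable \<mu>" if "a \<in> Acts G i" for a
    using bounded_loss_al_risk[OF i f x P(2) that] by (simp add: bounded_loss_def)
  show "g \<in> borel_measurable \<mu>"
    unfolding g_def by (rule grad_measurable[OF Acts(3)[OF i] a meas diff]) (use a in auto)
  have "bounded_differentiable_loss \<mu> (Acts G i) (al_risk G i f x)"
    unfolding bounded_differentiable_loss_def differentiable_on_def
  proof (intro conjI ballI exI)
    fix a z assume az: "a \<in> Acts G i" "z \<in> space \<mu>"
    show "\<bar>al_risk G i f x a z\<bar> \<le> max b (gbar i)"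
      "norm (grad (Acts G i) (\<lambda>y. al_risk G i f x y z) a) \<le> max b (gbar i)"
      using b[of a z] norm_gal[OF i f x az(1), of z] az by (auto simp: sp)
  qed (use meas diff in auto)
  from ep_regular[unfolded gradient_regular_def, rule_format, OF P(1) Acts(2)[OF i] Acts(3)[OF i] a this]
  show "W \<in> borel_measurable \<mu>" "(LINT z|\<mu>. W z) = 1"
    "grad (Acts G i) (objective G i \<mu> f x) a = (LINT z|\<mu>. W z *\<^sub>R g z)"
    unfolding W_def g_def objective_def by blast+
qed

text \<open>The epistemic weights have mean one, so the gradient at the true parameter can be moved
  under the posterior integral. What remains is at most \<open>wep i\<close> times the posterior
  mean of the gradient distance.\<close>

lemma objective_grad_distance:
  assumes i: "i \<in> Players G" and f: "f \<in> strategies G (others G i)" and x: "x \<in> Types G i" and a: "a \<in> Acts G i"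
    and \<mu>: "\<mu> \<in> posteriors G i" and s: "0 < s"
    and moment: "(\<integral>\<^sup>+z. ennreal ((norm (z - true_param G))\<^sup>2) \<partial>\<mu>) \<le> ennreal s"
  shows "objective G i (true_belief G) f x differentiable (at a within Acts G i)"
    "0 \<le> wep i"
    "norm (grad (Acts G i) (objective G i \<mu> f x) a - grad (Acts G i) (objective G i (true_belief G) f x) a)
      \<le> wep i * ((2 * wal i * gbar i + gbar i * lam i) * Leta i * (2 * s powr (r i / 2)) + 2 * gbar i * s / (e i)\<^sup>2)"
proof -
  note P = posteriors_belief[OF i \<mu>]
  interpret prob_space \<mu> by (rule P)
  have sp: "space \<mu> = Params G" using sets_eq_imp_space_eq[OF P(2)] by (simp add: space_restrict_space)
  let ?t = "true_param G"
  let ?g = "\<lambda>z. grad (Acts G i) (\<lambda>y. al_risk G i f x y z) a"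
  let ?W = "Wep \<mu> (Acts G i) (al_risk G i f x) a"
  note grad_true = grad_cong_diff[OF Acts(3)[OF i] a al_risk_gradient(3)[OF i f x a Params(2)]
      objective_true_belief[OF i f x]]
  show "objective G i (true_belief G) f x differentiable (at a within Acts G i)" by (rule grad_true(1))
  have W: "0 \<le> ?W z" "?W z \<le> wep i" if "z \<in> Params G" for z using Wep_range i f x a \<mu> that by auto
  show wep: "0 \<le> wep i" using W[OF Params(2)] by linarith
  note obj = objective_gradient[OF i f x a \<mu>]
  note nn = gbar_nonneg[OF i f x a] wal_nonneg[OF i f x a]
  have lam: "0 \<le> lam i" using lam_nonneg i by blast
  have ex: "0 < Leta i" "0 < r i" "r i \<le> 2" "0 < e i" using exponents i by auto
  define C where "C = 2 * wal i * gbar i + gbar i * lam i"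
  have C: "0 \<le> C" unfolding C_def using nn lam by simp
  define q where "q z = (norm (z - ?t))\<^sup>2" for z
  \<comment> \<open>The sum of the bound near the true parameter and the bound away from it; both
    are nonnegative, so \<open>h\<close> dominates in either case. It is affine in the squared
    distance \<open>q\<close>, hence the second moment alone controls its integral.\<close>
  define h where "h z = C * Leta i * (s powr (r i / 2) * (1 + q z / s)) + 2 * gbar i * q z / (e i)\<^sup>2" for z
  have q_nonneg: "0 \<le> q z" for z by (simp add: q_def)
  have q_meas: "q \<in> borel_measurable \<mu>"
    unfolding q_def by (subst measurable_cong_sets[OF P(2) refl]) (intro measurable_restrict_space1, measurable)
  have q_int: "integrable \<mu> q"
    using moment q_nonneg by (intro integrableI_nonneg q_meas) (auto simp: q_def intro: le_less_trans)
  have q_le: "(LINT z|\<mu>. q z) \<le> s"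
    using moment s q_int q_nonneg
    by (subst (asm) nn_integral_eq_integral) (auto simp: q_def[abs_def])
  have h_int: "integrable \<mu> h" unfolding h_def using q_int by simp
  have h_le: "(LINT z|\<mu>. h z) \<le> C * Leta i * (2 * s powr (r i / 2)) + 2 * gbar i * s / (e i)\<^sup>2"
  proof -
    have "(LINT z|\<mu>. h z) = C * Leta i * (s powr (r i / 2) * (1 + (LINT z|\<mu>. q z) / s)) + 2 * gbar i * (LINT z|\<mu>. q z) / (e i)\<^sup>2"
      unfolding h_def using q_int by (simp add: prob_space)
    also have "\<dots> \<le> C * Leta i * (s powr (r i / 2) * (1 + 1)) + 2 * gbar i * s / (e i)\<^sup>2"
      using q_le s C ex nn by (intro add_mono mult_left_mono divide_right_mono) auto
    finally show ?thesis by (simp add: mult_ac)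
  qed
  have g_le: "norm (?g z - ?g ?t) \<le> h z" if z: "z \<in> Params G" for z
  proof (cases "z \<in> ball ?t (e i)")
    case True
    have "norm (?g z - ?g ?t) \<le> C * dTV (cond G i x z) (cond G i x ?t)"
      unfolding C_def by (rule gal_dTV[OF i f x a z])
    also have "\<dots> \<le> C * (Leta i * norm (z - ?t) powr r i)"
      using cond_holder i x z True C by (intro mult_left_mono) auto
    also have "\<dots> \<le> C * (Leta i * (s powr (r i / 2) * (1 + q z / s)))"
      unfolding q_def using C ex s by (intro mult_left_mono powr_half_le) auto
    also have "\<dots> \<le> h z" using nn ex q_nonneg by (simp add: h_def mult.assoc)
    finally show ?thesis .
  next
    case False
    \<comment> \<open>Outside the ball \<open>q z / (e i)\<^sup>2\<close> is at least 1, as in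
      Chebyshev's inequality, and multiplies the crude bound \<open>2 * gbar i\<close>.\<close>
    then have "(e i)\<^sup>2 \<le> q z"
      unfolding q_def using ex by (intro power_mono) (auto simp: dist_norm norm_minus_commute)
    then have "2 * gbar i * 1 \<le> 2 * gbar i * (q z / (e i)\<^sup>2)"
      using nn ex by (intro mult_left_mono) auto
    moreover have "norm (?g z - ?g ?t) \<le> gbar i + gbar i"
      by (intro order_trans[OF norm_triangle_ineq4] add_mono norm_gal i f x a z Params)
    moreover have "0 \<le> C * Leta i * (s powr (r i / 2) * (1 + q z / s))"
      using C ex s q_nonneg by simp
    ultimately show ?thesis by (simp add: h_def)
  qed
  have W_int: "integrable \<mu> ?W"
    using W by (intro integrable_const_bound[of _ "wep i"] obj(1) AE_I2) (auto simp: sp)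
  have Wg_int: "integrable \<mu> (\<lambda>z. ?W z *\<^sub>R ?g z)"
  proof (rule integrable_const_bound[of _ "wep i * gbar i"])
    show "AE z in \<mu>. norm (?W z *\<^sub>R ?g z) \<le> wep i * gbar i"
      using W norm_gal[OF i f x a] by (intro AE_I2) (auto simp: sp intro!: mult_mono wep)
  qed (intro borel_measurable_scaleR obj)
  have "grad (Acts G i) (objective G i \<mu> f x) a - grad (Acts G i) (objective G i (true_belief G) f x) a
      = (LINT z|\<mu>. ?W z *\<^sub>R ?g z) - (LINT z|\<mu>. ?W z) *\<^sub>R ?g ?t"
    by (simp add: obj(2,3) grad_true(2))
  also have "\<dots> = (LINT z|\<mu>. ?W z *\<^sub>R (?g z - ?g ?t))"
    using W_int Wg_int by (simp add: scaleR_diff_right)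
  also have "norm \<dots> \<le> (LINT z|\<mu>. norm (?W z *\<^sub>R (?g z - ?g ?t)))" by (rule integral_norm_bound)
  also have "\<dots> \<le> (LINT z|\<mu>. wep i * h z)"
  proof (intro integral_mono integrable_norm integrable_mult_right h_int)
    show "integrable \<mu> (\<lambda>z. ?W z *\<^sub>R (?g z - ?g ?t))"
      unfolding scaleR_diff_right using W_int Wg_int by simp
    show "norm (?W z *\<^sub>R (?g z - ?g ?t)) \<le> wep i * h z" if "z \<in> space \<mu>" for z
      using W g_le that by (auto simp: sp intro!: mult_mono wep)
  qed
  also have "\<dots> = wep i * (LINT z|\<mu>. h z)" by simp
  also have "\<dots> \<le> wep i * (C * Leta i * (2 * s powr (r i / 2)) + 2 * gbar i * s / (e i)\<^sup>2)"
    by (intro mult_left_mono h_le wep)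
  finally show "norm (grad (Acts G i) (objective G i \<mu> f x) a - grad (Acts G i) (objective G i (true_belief G) f x) a)
      \<le> wep i * ((2 * wal i * gbar i + gbar i * lam i) * Leta i * (2 * s powr (r i / 2)) + 2 * gbar i * s / (e i)\<^sup>2)"
    by (simp add: C_def)
qed

end

section \<open>Convergence rate\<close>

text \<open>The gradient estimate for \<open>c2'\<close> exceeds the constant of the theorem by a factor up to \<open>4\<close>. The
  factor \<open>2\<close> on the term \<open>w L (wl g)\<close> comes from losses of both signs in the total variation distance, the
  other one from replacing Jensen's inequality by \<open>powr_half_le\<close>. Both are absorbed in \<open>c2\<close>.\<close>

lemma moment_rate:
  fixes c1 c1' c2 c2' \<rho> y r g L w wl l e' :: real
  assumes r: "0 < r" "r \<le> 2" "\<rho> \<le> r" "0 < \<rho>" and c: "0 < c1" "c1 \<le> c1'" "0 < c2'"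
    and c2: "4 * max (c2' powr (r / 2)) c2' \<le> c2" and y: "1 \<le> y"
    and nn: "0 \<le> w" "0 \<le> L" "0 \<le> wl" "0 \<le> g" "0 \<le> l"
  defines "s \<equiv> c2' * y powr (- c1')"
  shows "w * ((2 * wl * g + g * l) * L * (2 * s powr (r / 2)) + 2 * g * s / e'\<^sup>2)
    \<le> (w * L * (wl * g + g * l) + 2 * (w * g / e'\<^sup>2)) * max (c2 powr (r / 2)) c2 * y powr (- (\<rho> * c1 / 2))"
proof -
  let ?m = "max (c2' powr (r / 2)) c2'" and ?\<tau> = "y powr (- (\<rho> * c1 / 2))"
  have m: "0 \<le> ?m" using c by simp
  \<comment> \<open>Since y \<ge> 1, lowering the decay exponent only enlarges the bound. Both
    exponents, \<open>c1' * (r / 2)\<close> from the near term and \<open>c1'\<close> from the far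
    term, are at least the common one because r \<le> 2.\<close>
  have exp1: "\<rho> * c1 / 2 \<le> c1' * (r / 2)"
    using mult_mono[of \<rho> r c1 c1'] r c by (simp add: mult_ac)
  moreover have "c1' * (r / 2) \<le> c1'" using r c by (simp add: field_simps)
  ultimately have exp2: "\<rho> * c1 / 2 \<le> c1'" by linarith
  have "s powr (r / 2) = c2' powr (r / 2) * y powr (- (c1' * (r / 2)))"
    by (simp add: s_def powr_mult powr_powr)
  also have "\<dots> \<le> ?m * ?\<tau>"
    using exp1 y m by (intro mult_mono powr_mono) auto
  finally have s1: "s powr (r / 2) \<le> ?m * ?\<tau>" .
  have s2: "s \<le> ?m * ?\<tau>"
    unfolding s_def using exp2 y m by (intro mult_mono powr_mono) auto
  have "w * ((2 * wl * g + g * l) * L * (2 * s powr (r / 2)) + 2 * g * s / e'\<^sup>2)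
      \<le> w * ((4 * (wl * g + g * l)) * L * (?m * ?\<tau>) + 4 * (2 * g * (?m * ?\<tau>) / e'\<^sup>2))"
  proof (intro mult_left_mono add_mono nn)
    have "(2 * wl * g + g * l) * L * (2 * s powr (r / 2)) = (4 * wl * g + 2 * (g * l)) * L * s powr (r / 2)"
      by (simp add: algebra_simps)
    also have "\<dots> \<le> (4 * (wl * g + g * l)) * L * (?m * ?\<tau>)"
      using nn s1 by (intro mult_mono) auto
    finally show "(2 * wl * g + g * l) * L * (2 * s powr (r / 2)) \<le> (4 * (wl * g + g * l)) * L * (?m * ?\<tau>)" .
    \<comment> \<open>The far term is enlarged as well, only to give both terms the same factor
      4.\<close>
    have le4: "a \<le> 4 * b" if "a \<le> b" "0 \<le> b" for a b :: real using that by linarith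
    show "2 * g * s / e'\<^sup>2 \<le> 4 * (2 * g * (?m * ?\<tau>) / e'\<^sup>2)"
      using nn s2 m by (intro le4 divide_right_mono mult_left_mono divide_nonneg_nonneg mult_nonneg_nonneg) auto
  qed
  also have "\<dots> = (w * L * (wl * g + g * l) + 2 * (w * g / e'\<^sup>2)) * (4 * ?m) * ?\<tau>"
    by (simp add: field_simps)
  also have "\<dots> \<le> (w * L * (wl * g + g * l) + 2 * (w * g / e'\<^sup>2)) * max (c2 powr (r / 2)) c2 * ?\<tau>"
    using nn c2 by (intro mult_right_mono mult_left_mono) auto
  finally show ?thesis .
qed

context regular_game
begin

text \<open>The deterministic form of (ii), for one history on which every player's posterior is
  defined and satisfies the moment bound. The players' constants \<open>c1'\<close> and
  \<open>c2'\<close> are merged into one pair.\<close>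

lemma equilibrium_rate:
  assumes t: "2 \<le> t" and h: "h \<in> space (histories G t)"
    and def: "\<And>i. i \<in> Players G \<Longrightarrow> posterior_defined G i t h"
    and ft: "BNE_RABL G (\<lambda>i. posterior G i t h) ft" and fstar: "BNE_RABL G (\<lambda>i. true_belief G) fstar"
    and moment: "\<And>i. i \<in> Players G \<Longrightarrow>
      (\<integral>\<^sup>+z. ennreal ((norm (z - true_param G))\<^sup>2) \<partial>posterior G i t h) \<le> ennreal (c2' i * (real t - 1) powr (- c1' i))"
    and c: "0 < c1" "\<And>i. i \<in> Players G \<Longrightarrow> c1 \<le> c1' i" "\<And>i. i \<in> Players G \<Longrightarrow> 0 < c2' i"
    and c2: "\<And>i. i \<in> Players G \<Longrightarrow> 4 * max (c2' i powr (r i / 2)) (c2' i) \<le> c2"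
  shows "strategy_norm G (\<lambda>j x. ft j x - fstar j x) \<le>
      (MAX i\<in>Players G. \<Sum>j\<in>Players G. Inv $$ (i, j) *
         (1 / M j * (wep j * Leta j * (wal j * gbar j + gbar j * lam j) + 2 * (wep j * gbar j / (e j)\<^sup>2))
          * max (c2 powr (r j / 2)) c2))
      * (real t - 1) powr (- ((MIN i\<in>Players G. r i) * c1 / 2))"
proof -
  let ?\<rho> = "MIN i\<in>Players G. r i"
  let ?\<tau> = "(real t - 1) powr (- (?\<rho> * c1 / 2))"
  define D where "D j = 1 / M j * (wep j * Leta j * (wal j * gbar j + gbar j * lam j) + 2 * (wep j * gbar j / (e j)\<^sup>2))
      * max (c2 powr (r j / 2)) c2" for j
  have \<mu>: "posterior G i t h \<in> posteriors G i" if "i \<in> Players G" for i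
    using t h def[OF that] unfolding posteriors_def by (intro CollectI exI[of _ t] exI[of _ h]) auto
  have fs: "fstar \<in> strategies G (Players G)" using fstar by (simp add: BNE_RABL_def)
  have ex: "0 < Leta i" "0 < r i" "r i \<le> 2" "0 \<le> lam i" if "i \<in> Players G" for i
    using exponents lam_nonneg that by auto
  have "?\<rho> \<in> r ` Players G" using players by (intro Min_in) auto
  then have \<rho>: "0 < ?\<rho>" "\<And>i. i \<in> Players G \<Longrightarrow> ?\<rho> \<le> r i" using ex by auto
  have y: "1 \<le> real t - 1" using t by simp
  note dist = objective_grad_distance[OF _ strategies_others[OF fs] _ strategiesD[OF fs] \<mu> _ moment]
  obtain i where i: "i \<in> Players G"
    and le: "strategy_norm G (\<lambda>j x. fstar j x - ft j x) \<le> (\<Sum>j\<in>Players G. Inv $$ (i, j) * (D j * ?\<tau>))"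
  \<comment> \<open>The true equilibrium takes the place of \<open>f\<close>, so the gradients are
    evaluated at its actions and the posterior takes the place of \<mu>'. The order of the two
    strategies is reversed afterwards.\<close>
  proof (rule equilibrium_distance[OF \<mu> fstar ft])
    fix i x assume i: "i \<in> Players G" and x: "x \<in> Types G i"
    have pos: "0 < c2' i * (real t - 1) powr (- c1' i)" using c(3)[OF i] y by simp
    note d = dist[OF i x i x i pos i]
    show "objective G i (true_belief G) fstar x differentiable (at (fstar i x) within Acts G i)" by (rule d(1))
    note nn = gbar_nonneg[OF i strategies_others[OF fs] x strategiesD[OF fs i x]]
      wal_nonneg[OF i strategies_others[OF fs] x strategiesD[OF fs i x]]
    have "norm (grad (Acts G i) (objective G i (posterior G i t h) fstar x) (fstar i x) -
        grad (Acts G i) (objective G i (true_belief G) fstar x) (fstar i x))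
        \<le> (wep i * Leta i * (wal i * gbar i + gbar i * lam i) + 2 * (wep i * gbar i / (e i)\<^sup>2))
          * max (c2 powr (r i / 2)) c2 * ?\<tau>"
      using nn ex[OF i] d(2)
      by (intro order_trans[OF d(3) moment_rate] \<rho> c c2 i y) auto
    then show "1 / M i * norm (grad (Acts G i) (objective G i (posterior G i t h) fstar x) (fstar i x) -
        grad (Acts G i) (objective G i (true_belief G) fstar x) (fstar i x)) \<le> D i * ?\<tau>"
      using M_pos[OF i] unfolding D_def mult.assoc by (intro mult_left_mono) (auto simp: mult.assoc)
  qed
  have "strategy_norm G (\<lambda>j x. ft j x - fstar j x) = strategy_norm G (\<lambda>j x. fstar j x - ft j x)"
    unfolding strategy_norm_def by (subst norm_minus_commute) (rule refl)
  also note le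
  also have "(\<Sum>j\<in>Players G. Inv $$ (i, j) * (D j * ?\<tau>)) = (\<Sum>j\<in>Players G. Inv $$ (i, j) * D j) * ?\<tau>"
    by (simp add: sum_distrib_right mult.assoc)
  also have "\<dots> \<le> (MAX i\<in>Players G. \<Sum>j\<in>Players G. Inv $$ (i, j) * D j) * ?\<tau>"
    using i by (intro mult_right_mono Max_ge) auto
  finally show ?thesis by (simp only: D_def)
qed

lemma prob_space_histories: "prob_space (histories G t)"
proof -
  interpret prob_space "eta G (true_param G)"
    using game Params(2) by (auto simp: bayes_game_def game_distributions_def)
  show ?thesis unfolding histories_def by (intro prob_space_PiM prob_space_axioms)
qed

lemma equilibrium_convergence:
  assumes ft: "\<forall>t\<ge>1. \<forall>h\<in>space (histories G t). (\<forall>i\<in>Players G. posterior_defined G i t h) \<longrightarrow>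
      BNE_RABL G (\<lambda>i. posterior G i t h) (ft t h)"
    and fstar: "BNE_RABL G (\<lambda>i. true_belief G) fstar"
    and C1: "\<forall>i\<in>Players G. \<forall>\<epsilon>\<in>{0<..<1}. \<exists>c1>0. \<exists>c2>0. \<exists>T\<ge>2. \<forall>t::nat. T < t \<longrightarrow>
      prob_at_least (histories G t) (1 - \<epsilon>)
        (\<lambda>h. (\<integral>\<^sup>+z. ennreal ((norm (z - true_param G))\<^sup>2) \<partial>posterior G i t h)
               \<le> ennreal (c2 * (real t - 1) powr (- c1)))"
    and \<epsilon>: "\<epsilon> \<in> {0<..<1}"
  shows "\<exists>c1>0. \<exists>c2>0. \<exists>T\<ge>2. \<forall>t::nat. T < t \<longrightarrow>
    prob_at_least (histories G t) (1 - \<epsilon>)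
      (\<lambda>h. strategy_norm G (\<lambda>j x. ft t h j x - fstar j x) \<le>
        (MAX i\<in>Players G. \<Sum>j\<in>Players G. Inv $$ (i, j) *
          (1 / M j * (wep j * Leta j * (wal j * gbar j + gbar j * lam j) + 2 * (wep j * gbar j / (e j)\<^sup>2))
           * max (c2 powr (r j / 2)) c2))
        * (real t - 1) powr (- ((MIN i\<in>Players G. r i) * c1 / 2)))"
proof -
  let ?P = "\<lambda>c1 c2 i t h. (\<integral>\<^sup>+z. ennreal ((norm (z - true_param G))\<^sup>2) \<partial>posterior G i t h)
      \<le> ennreal (c2 * (real t - 1) powr (- c1))"
  have fin: "finite (Players G)" "Players G \<noteq> {}" using players by auto
  \<comment> \<open>(C1) is invoked at this smaller level for each player, so that the union bound
    over the players costs \<epsilon> in total.\<close>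
  have "\<epsilon> / card (Players G) \<in> {0<..<1}"
    using \<epsilon> players by (auto simp: divide_less_eq intro: less_le_trans[of \<epsilon> 1])
  with C1 have "\<forall>i\<in>Players G. \<exists>c1>0. \<exists>c2>0. \<exists>T\<ge>2. \<forall>t::nat. T < t \<longrightarrow>
      prob_at_least (histories G t) (1 - \<epsilon> / card (Players G)) (?P c1 c2 i t)" by blast
  then obtain c1' c2' T' where c': "\<And>i. i \<in> Players G \<Longrightarrow> 0 < c1' i \<and> 0 < c2' i \<and> 2 \<le> T' i"
    and C: "\<And>i t. i \<in> Players G \<Longrightarrow> T' i < t \<Longrightarrow>
      prob_at_least (histories G t) (1 - \<epsilon> / card (Players G)) (?P (c1' i) (c2' i) i t)"
    by metis
  \<comment> \<open>The slowest decay among the players and, below, the latest starting round suit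
    everyone. For \<open>c2\<close> the sum of the positive \<open>m i\<close> dominates each of
    them.\<close>
  define c1 where "c1 = (MIN i\<in>Players G. c1' i)"
  define m where "m i = 4 * max (c2' i powr (r i / 2)) (c2' i)" for i
  define c2 where "c2 = (\<Sum>i\<in>Players G. m i)"
  define T where "T = (MAX i\<in>Players G. T' i)"
  have c1: "0 < c1" "\<And>i. i \<in> Players G \<Longrightarrow> c1 \<le> c1' i"
    unfolding c1_def using c' fin by auto
  have m: "0 < m i" if "i \<in> Players G" for i using c'[OF that] by (simp add: m_def less_max_iff_disj)
  have c2_pos: "0 < c2" unfolding c2_def using m by (intro sum_pos fin)
  have c2_ge: "m i \<le> c2" if "i \<in> Players G" for i
    unfolding c2_def using that m fin by (intro member_le_sum) (auto simp: less_imp_le)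
  have T: "T' i \<le> T" if "i \<in> Players G" for i unfolding T_def using fin that by auto
  obtain i0 where "i0 \<in> Players G" using fin by blast
  then have T2: "2 \<le> T" using T[of i0] c'[of i0] by linarith
  show ?thesis
  proof (rule exI[of _ c1], rule conjI[OF c1(1)], rule exI[of _ c2], rule conjI[OF c2_pos],
      rule exI[of _ T], rule conjI[OF T2], intro allI impI)
    fix t assume t: "T < t"
    have "prob_at_least (histories G t) (1 - \<epsilon>) (\<lambda>h. \<forall>i\<in>Players G. ?P (c1' i) (c2' i) i t h)"
      using T t by (intro prob_at_least_Ball prob_space_histories fin C) (auto intro: le_less_trans)
    \<comment> \<open>\<open>ft t h\<close> is known to be an equilibrium only where all posteriors
      are defined; this holds almost surely and lowers no probability.\<close>
    moreover have "AE h in histories G t. \<forall>i\<in>Players G. posterior_defined G i t h"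
      using game T2 t fin by (intro AE_finite_allI) (auto simp: bayes_game_def game_beliefs_def)
    ultimately have "prob_at_least (histories G t) (1 - \<epsilon>) (\<lambda>h. h \<in> space (histories G t) \<and>
        (\<forall>i\<in>Players G. ?P (c1' i) (c2' i) i t h) \<and> (\<forall>i\<in>Players G. posterior_defined G i t h))"
      by (rule prob_at_least_AE[OF prob_space_histories])
    then show "prob_at_least (histories G t) (1 - \<epsilon>)
      (\<lambda>h. strategy_norm G (\<lambda>j x. ft t h j x - fstar j x) \<le>
        (MAX i\<in>Players G. \<Sum>j\<in>Players G. Inv $$ (i, j) *
          (1 / M j * (wep j * Leta j * (wal j * gbar j + gbar j * lam j) + 2 * (wep j * gbar j / (e j)\<^sup>2))
           * max (c2 powr (r j / 2)) c2))
        * (real t - 1) powr (- ((MIN i\<in>Players G. r i) * c1 / 2)))"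
    proof (rule prob_at_least_mono)
      fix h assume h: "h \<in> space (histories G t) \<and>
        (\<forall>i\<in>Players G. ?P (c1' i) (c2' i) i t h) \<and> (\<forall>i\<in>Players G. posterior_defined G i t h)"
      show "strategy_norm G (\<lambda>j x. ft t h j x - fstar j x) \<le>
        (MAX i\<in>Players G. \<Sum>j\<in>Players G. Inv $$ (i, j) *
          (1 / M j * (wep j * Leta j * (wal j * gbar j + gbar j * lam j) + 2 * (wep j * gbar j / (e j)\<^sup>2))
           * max (c2 powr (r j / 2)) c2))
        * (real t - 1) powr (- ((MIN i\<in>Players G. r i) * c1 / 2))"
      proof (rule equilibrium_rate[where c1' = c1' and c2' = c2'])
        show "BNE_RABL G (\<lambda>i. posterior G i t h) (ft t h)" using ft h T2 t by auto
        show "2 \<le> t" using T2 t by linarith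
        show "4 * max (c2' i powr (r i / 2)) (c2' i) \<le> c2" if "i \<in> Players G" for i
          using c2_ge[OF that] by (simp only: m_def)
      qed (use h c' c1 fstar in auto)
    qed
  qed
qed

end

theorem theorem6p1:
  fixes G :: "('a::euclidean_space, 'b::euclidean_space, 'z::euclidean_space) bayes_game"
    and M kal0 kal1 kep0 kep1 :: "nat \<Rightarrow> real"
    and L0 L1 K :: "nat \<Rightarrow> nat \<Rightarrow> real"
    and Z0 :: "nat \<Rightarrow> 'z set"
    and Gam Inv :: "real mat"
  assumes game: "bayes_game G"
    and A1: "\<And>i. i \<in> Players G \<Longrightarrow> M i > 0"
            "\<And>i a \<theta>. i \<in> Players G \<Longrightarrow> a \<in> action_profiles G \<Longrightarrow> \<theta> \<in> type_profiles G \<Longrightarrow>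
               strongly_convex_on (M i) (Acts G i) (\<lambda>x. cost G i (a(i := x)) \<theta>)"
    and A2: "\<And>i x \<epsilon>. i \<in> Players G \<Longrightarrow> x \<in> Types G i \<Longrightarrow> \<epsilon> > 0 \<Longrightarrow>
               \<exists>\<delta>>0. \<forall>x'\<in>Types G i. \<forall>z\<in>Params G. norm (x' - x) \<le> \<delta> \<longrightarrow>
                 dTV (cond G i x z) (cond G i x' z) \<le> \<epsilon>"
    and A3: "\<And>P :: (nat \<Rightarrow> 'b) measure. prob_space P \<Longrightarrow> convex_risk_measure P (risk (rho_al G) P)"
            "\<And>P :: 'z measure. prob_space P \<Longrightarrow> convex_risk_measure P (risk (rho_ep G) P)"
    and A4: "\<And>b \<epsilon> :: real. \<epsilon> > 0 \<Longrightarrow>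
               \<exists>\<delta>>0. \<forall>P Q. prob_space P \<and> prob_space Q \<and> sets P = sets borel \<and> sets Q = sets borel \<and>
                 (AE y in P. \<bar>y\<bar> \<le> b) \<and> (AE y in Q. \<bar>y\<bar> \<le> b) \<and> dTV P Q \<le> \<delta> \<longrightarrow>
                 \<bar>rho_al G P - rho_al G Q\<bar> \<le> \<epsilon>"
    and B1: "\<And>i a \<theta>. i \<in> Players G \<Longrightarrow> a \<in> action_profiles G \<Longrightarrow> \<theta> \<in> type_profiles G \<Longrightarrow>
               (\<lambda>x. cost G i (a(i := x)) \<theta>) differentiable_on Acts G i"
    and B2: "\<And>i j. i \<in> Players G \<Longrightarrow> j \<in> others G i \<Longrightarrow> 0 \<le> L0 i j \<and> 0 \<le> L1 i j"
            "\<And>i a a' \<theta>. i \<in> Players G \<Longrightarrow> a \<in> action_profiles G \<Longrightarrow> a' \<in> action_profiles G \<Longrightarrow>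
               \<theta> \<in> type_profiles G \<Longrightarrow> a' i = a i \<Longrightarrow>
               \<bar>cost G i a' \<theta> - cost G i a \<theta>\<bar> \<le> (\<Sum>j\<in>others G i. L0 i j * norm (a' j - a j)) \<and>
               norm (grad (Acts G i) (\<lambda>x. cost G i (a'(i := x)) \<theta>) (a i) -
                     grad (Acts G i) (\<lambda>x. cost G i (a(i := x)) \<theta>) (a i))
                 \<le> (\<Sum>j\<in>others G i. L1 i j * norm (a' j - a j))"
    and Z0: "\<And>i. i \<in> Players G \<Longrightarrow> Z0 i \<subseteq> Params G \<and> (AE z in prior G i. z \<in> Z0 i)"
    and B3: "\<And>i. i \<in> Players G \<Longrightarrow> 0 \<le> kal0 i \<and> 0 \<le> kal1 i"
            "\<And>i f x z. i \<in> Players G \<Longrightarrow> f \<in> strategies G (others G i) \<Longrightarrow> x \<in> Types G i \<Longrightarrow>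
               z \<in> Z0 i \<Longrightarrow> (\<lambda>y. al_risk G i f x y z) differentiable_on Acts G i"
            "\<And>i f f' x a z. i \<in> Players G \<Longrightarrow> f \<in> strategies G (others G i) \<Longrightarrow>
               f' \<in> strategies G (others G i) \<Longrightarrow> x \<in> Types G i \<Longrightarrow> a \<in> Acts G i \<Longrightarrow> z \<in> Z0 i \<Longrightarrow>
               norm (grad (Acts G i) (\<lambda>y. al_risk G i f x y z) a -
                     grad (Acts G i) (\<lambda>y. al_risk G i f' x y z) a)
                 \<le> kal1 i * (SUP \<xi>\<in>opp_types G i. norm (grad (Acts G i) (\<lambda>y. loss G i f x y \<xi>) a -
                                                        grad (Acts G i) (\<lambda>y. loss G i f' x y \<xi>) a))
                   + kal0 i * (SUP \<xi>\<in>opp_types G i. \<bar>loss G i f x a \<xi> - loss G i f' x a \<xi>\<bar>)"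
    and B4: "\<And>i. i \<in> Players G \<Longrightarrow> 0 \<le> kep0 i \<and> 0 \<le> kep1 i"
            "\<And>i \<mu> f x. i \<in> Players G \<Longrightarrow> \<mu> \<in> posteriors G i \<Longrightarrow> f \<in> strategies G (others G i) \<Longrightarrow>
               x \<in> Types G i \<Longrightarrow> objective G i \<mu> f x differentiable_on Acts G i"
            "\<And>i \<mu> f f' x a. i \<in> Players G \<Longrightarrow> \<mu> \<in> posteriors G i \<Longrightarrow> f \<in> strategies G (others G i) \<Longrightarrow>
               f' \<in> strategies G (others G i) \<Longrightarrow> x \<in> Types G i \<Longrightarrow> a \<in> Acts G i \<Longrightarrow>
               norm (grad (Acts G i) (objective G i \<mu> f x) a -
                     grad (Acts G i) (objective G i \<mu> f' x) a)
                 \<le> kep1 i * (SUP z\<in>Z0 i. norm (grad (Acts G i) (\<lambda>y. al_risk G i f x y z) a -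
                                                grad (Acts G i) (\<lambda>y. al_risk G i f' x y z) a))
                   + kep0 i * (SUP z\<in>Z0 i. \<bar>al_risk G i f x a z - al_risk G i f' x a z\<bar>)"
    and K: "\<And>i j. K i j = (if i = j then 0
              else kep1 i * (kal1 i * L1 i j + kal0 i * L0 i j) + kep0 i * L0 i j)"
    and Gam: "Gam = mat (n_players G) (n_players G) (\<lambda>(i, j). K i j / M i)"
    and B5: "spectral_radius (map_mat complex_of_real Gam) < 1"
    and Inv: "Inv = the (mat_inverse (1\<^sub>m (n_players G) - Gam))"
  shows
    \<comment> \<open>(i)\<close>
    "(\<forall>\<mu> \<mu>' f f'.
        (\<forall>i\<in>Players G. \<mu> i \<in> posteriors G i \<and> \<mu>' i \<in> posteriors G i) \<longrightarrow>
        BNE_RABL G \<mu> f \<longrightarrow> BNE_RABL G \<mu>' f' \<longrightarrow>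
        ereal (strategy_norm G (\<lambda>j x. f j x - f' j x)) \<le>
        (MAX i\<in>Players G. \<Sum>j\<in>Players G. ereal (Inv $$ (i, j)) *
           (ereal (1 / M j) *
            (SUP x\<in>Types G j. ereal (norm (grad (Acts G j) (objective G j (\<mu>' j) f x) (f j x) -
                                           grad (Acts G j) (objective G j (\<mu> j) f x) (f j x)))))))
     \<and>
     \<comment> \<open>(ii)\<close>
     (\<forall>ft fstar Wal Wep wal wep lam Leta r e gbar.
        (\<forall>t\<ge>1. \<forall>h\<in>space (histories G t). (\<forall>i\<in>Players G. posterior_defined G i t h) \<longrightarrow>
           BNE_RABL G (\<lambda>i. posterior G i t h) (ft t h)) \<longrightarrow>
        BNE_RABL G (\<lambda>i. true_belief G) fstar \<longrightarrow>
        \<comment> \<open>(C1)\<close>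
        (\<forall>i\<in>Players G. \<forall>\<epsilon>\<in>{0<..<1}. \<exists>c1>0. \<exists>c2>0. \<exists>T\<ge>2. \<forall>t::nat. T < t \<longrightarrow>
           prob_at_least (histories G t) (1 - \<epsilon>)
             (\<lambda>h. (\<integral>\<^sup>+z. ennreal ((norm (z - true_param G))\<^sup>2) \<partial>posterior G i t h)
                    \<le> ennreal (c2 * (real t - 1) powr (- c1)))) \<longrightarrow>
        \<comment> \<open>(C2)\<close>
        gradient_regular (rho_al G) Wal \<longrightarrow>
        gradient_regular (rho_ep G) Wep \<longrightarrow>
        (\<forall>i\<in>Players G. \<forall>f\<in>strategies G (others G i). \<forall>x\<in>Types G i. \<forall>a\<in>Acts G i. \<forall>z\<in>Params G.
           \<forall>\<xi>\<in>opp_types G i.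
             Wal (cond G i x z) (Acts G i) (loss G i f x) a \<xi> \<in> {0..wal i}) \<longrightarrow>
        (\<forall>i\<in>Players G. \<forall>f\<in>strategies G (others G i). \<forall>x\<in>Types G i. \<forall>a\<in>Acts G i.
           \<forall>\<mu>\<in>posteriors G i. \<forall>z\<in>Params G.
             Wep \<mu> (Acts G i) (al_risk G i f x) a z \<in> {0..wep i}) \<longrightarrow>
        (\<forall>i\<in>Players G. 0 \<le> lam i) \<longrightarrow>
        (\<forall>i\<in>Players G. \<forall>f\<in>strategies G (others G i). \<forall>x\<in>Types G i. \<forall>a\<in>Acts G i. \<forall>z\<in>Params G.
           (LINT \<xi>|cond G i x (true_param G).
              \<bar>Wal (cond G i x z) (Acts G i) (loss G i f x) a \<xi> -
               Wal (cond G i x (true_param G)) (Acts G i) (loss G i f x) a \<xi>\<bar>)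
             \<le> lam i * dTV (cond G i x z) (cond G i x (true_param G))) \<longrightarrow>
        \<comment> \<open>(C3)\<close>
        (\<forall>i\<in>Players G. 0 < Leta i \<and> 0 < r i \<and> r i \<le> 2 \<and> 0 < e i) \<longrightarrow>
        (\<forall>i\<in>Players G. \<forall>x\<in>Types G i. \<forall>z\<in>Params G \<inter> ball (true_param G) (e i).
           dTV (cond G i x z) (cond G i x (true_param G))
             \<le> Leta i * norm (z - true_param G) powr r i) \<longrightarrow>
        \<comment> \<open>(C4)\<close>
        (\<forall>i\<in>Players G. \<forall>a\<in>action_profiles G. \<forall>\<theta>\<in>type_profiles G.
           norm (grad (Acts G i) (\<lambda>x. cost G i (a(i := x)) \<theta>) (a i)) \<le> gbar i) \<longrightarrow>
        (\<forall>\<epsilon>\<in>{0<..<1}. \<exists>c1>0. \<exists>c2>0. \<exists>T\<ge>2. \<forall>t::nat. T < t \<longrightarrow>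
           prob_at_least (histories G t) (1 - \<epsilon>)
             (\<lambda>h. strategy_norm G (\<lambda>j x. ft t h j x - fstar j x) \<le>
                (MAX i\<in>Players G. \<Sum>j\<in>Players G. Inv $$ (i, j) *
                   (1 / M j *
                    (wep j * Leta j * (wal j * gbar j + gbar j * lam j)
                       + 2 * (wep j * gbar j / (e j)\<^sup>2))
                    * max (c2 powr (r j / 2)) c2))
                * (real t - 1) powr (- ((MIN i\<in>Players G. r i) * c1 / 2)))))"
proof (rule conjI, goal_cases)
  interpret learning_game G M kal0 kal1 kep0 kep1 L0 L1 K Z0 Gam Inv
    by unfold_locales (fact game A1 A3 B1 B2 Z0 B3(1,3) B4 K Gam B5 Inv)+
  case 1
  show ?case by (intro allI impI equilibrium_stability) blast+
  case 2
  show ?case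
  proof (intro allI impI ballI, goal_cases)
    case prems: (1 ft fstar Wal Wep wal wep lam Leta r e gbar \<epsilon>)
    interpret regular_game G M kal0 kal1 kep0 kep1 L0 L1 K Z0 Gam Inv Wal Wep wal wep lam Leta r e gbar
      by unfold_locales (fact prems)+
    show ?case by (rule equilibrium_convergence[OF prems(1,2,3,13)])
  qed
qed

end
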